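(* Let $p$ be a prime number. For any odd integer $\lambda \geq 1$ and any integer $\mu \geq 0$, there exists an unramified $\mathbb{Z}_p$-covering $X_\infty/X$ of connected graphs satisfying $\lambda(X_\infty/X) = \lambda$ and $\mu(X_\infty/X) = \mu$. Indeed, such a covering exists with $X$ a bouquet (i.e., a graph with a single vertex).
   Context: Graphs (Serre's formalism): a graph $X$ consists of finite sets $V_X$ (vertices) and $\mathbb{E}_X$ (edges, oriented), an involution $e \mapsto \overline{e}$ of $\mathbb{E}_X$ without fixed elements, and maps $s,t:\mathbb{E}_X \to V_X$ with $s(\overline{e}) = t(e)$, $t(\overline{e}) = s(e)$. So multi-edges and loops are allowed, and each pair $\{e,\overline{e}\}$ is one undirected edge. $\kappa_X$ denotes the number of spanning trees of $X$ (as an undirected multigraph, undirected edges being the pairs $\{e,\overline e\}$). Unramified $\mathbb{Z}_p$-coverings: let $\Gamma$ be a profinite group, written multiplicatively, isomorphic to $\mathbb{Z}_p$, and $\Gamma_n = \Gamma/\Gamma^{p^n}$ for $n \ge 0$. A voltage assignment is a map $\alpha: \mathbb{E}_X \to \Gamma$ with $\alpha(\overline{e}) = \alpha(e)^{-1}$ for all $e$. The derived graph $X_n$ has $V_{X_n} = \Gamma_n \times V_X$, $\mathbb{E}_{X_n} = \Gamma_n \times \mathbb{E}_X$, with $\overline{(\gamma,e)} = (\gamma\cdot\alpha(e),\overline{e})$, $s((\gamma,e)) = (\gamma,s(e))$, $t((\gamma,e)) = (\gamma\cdot\alpha(e),t(e))$. The tower $X = X_0 \leftarrow X_1 \leftarrow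 X_2 \leftarrow\cdots$ (with maps induced by the projections $\Gamma_{n'} \to \Gamma_n$), provided all $X_n$ are connected, is an unramified $\mathbb{Z}_p$-covering of connected graphs, written $X_\infty/X$; every unramified $\mathbb{Z}_p$-covering of connected graphs is, up to isomorphism, of this form, and this may be taken as the definition. Iwasawa invariants: for such $X_\infty/X$ it is known that there are unique non-negative integers $\lambda(X_\infty/X)$, $\mu(X_\infty/X)$ and an integer $\nu$ such that $\operatorname{ord}_p(\kappa_{X_n}) = \lambda(X_\infty/X)\, n + \mu(X_\infty/X)\, p^n + \nu$ for all sufficiently large $n$, where $\operatorname{ord}_p$ is the $p$-adic valuation with $\operatorname{ord}_p(p)=1$. *)

theory Defs
  imports
    "Graph_Theory.Bidirected_Digraph"
    "Graph_Theory.Digraph_Component"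
    "HOL-Algebra.Product_Groups"
    "HOL-Computational_Algebra.Primes"
begin

section \<open>Graphs in Serre's formalism\<close>

text \<open>
  The axioms of \<^locale>\<open>bidirected_digraph\<close> say that \<open>arev\<close> is an involution of the arc set
  without fixed elements that interchanges tail (source) and head (target); outside the arc set
  \<open>arev\<close> is the identity by convention. Loops and multiple arcs are allowed.
\<close>

locale serre_graph = bidirected_digraph G arev + fin_digraph G
  for G :: "('v, 'e) pre_digraph" and arev :: "'e \<Rightarrow> 'e"

definition bouquet :: "('v, 'e) pre_digraph \<Rightarrow> bool" where
  "bouquet G \<longleftrightarrow> card (verts G) = 1"

definition undirected_edges :: "('v, 'e) pre_digraph \<Rightarrow> ('e \<Rightarrow> 'e) \<Rightarrow> 'e set set" where
  "undirected_edges G arev = (\<lambda>e. {e, arev e}) ` arcs G"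

text \<open>
  The library's \<^const>\<open>pre_digraph.cycle\<close> is a nonempty closed directed walk without repeated
  vertices. In a bidirected graph, running along an edge and back is such a cycle, so
  the library's \<^const>\<open>tree\<close> cannot be used here: a cycle of the undirected multigraph is one that
  does not use both an arc and its reverse. A loop is a cycle of length one, and two parallel
  edges give a cycle of length two.
\<close>

definition undirected_cycle :: "('v, 'e) pre_digraph \<Rightarrow> ('e \<Rightarrow> 'e) \<Rightarrow> 'e list \<Rightarrow> bool" where
  "undirected_cycle G arev c \<longleftrightarrow> pre_digraph.cycle G c \<and> (\<forall>e\<in>set c. arev e \<notin> set c)"

definition undirected_tree :: "('v, 'e) pre_digraph \<Rightarrow> ('e \<Rightarrow> 'e) \<Rightarrow> bool" where
  "undirected_tree G arev \<longleftrightarrow>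
     Digraph_Component.connected G \<and> (\<nexists>c. undirected_cycle G arev c)"

definition spanning_trees :: "('v, 'e) pre_digraph \<Rightarrow> ('e \<Rightarrow> 'e) \<Rightarrow> 'e set set set" where
  "spanning_trees G arev =
     {T. T \<subseteq> undirected_edges G arev \<and> undirected_tree (G\<lparr>arcs := \<Union>T\<rparr>) arev}"

definition num_spanning_trees :: "('v, 'e) pre_digraph \<Rightarrow> ('e \<Rightarrow> 'e) \<Rightarrow> nat" where
  "num_spanning_trees G arev = card (spanning_trees G arev)"


section \<open>The group of $p$-adic integers\<close>

text \<open>
  The inverse limit of the groups $\mathbf{Z}/p^n\mathbf{Z}$, inside their product. As a
  HOL-Algebra group it is written multiplicatively; its operation is addition of $p$-adic integers.
\<close>

definition padic_int_group :: "nat \<Rightarrow> (nat \<Rightarrow> int) monoid" where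
  "padic_int_group p =
     (let P = product_group UNIV (\<lambda>n. integer_mod_group (p ^ n))
      in P\<lparr>carrier := {x \<in> carrier P. \<forall>m n. m \<le> n \<longrightarrow> x n mod int (p ^ m) = x m}\<rparr>)"

lemma padic_int_subgroup:
  assumes "p > 0"
  shows "subgroup (carrier (padic_int_group p))
           (product_group UNIV (\<lambda>n. integer_mod_group (p ^ n)))"
    (is "subgroup ?H ?P")
proof -
  interpret P: group ?P by simp
  have dv: "int p ^ m dvd int p ^ n" if "m \<le> n" for m n
    using that by (rule le_imp_power_dvd)
  have cH: "?H = {x \<in> carrier ?P. \<forall>m n. m \<le> n \<longrightarrow> x n mod int (p ^ m) = x m}"
    by (simp add: padic_int_group_def Let_def)
  show ?thesis
  proof (rule P.subgroupI)
    show "?H \<subseteq> carrier ?P" by (auto simp: cH)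
    have "\<one>\<^bsub>?P\<^esub> \<in> ?H"
      unfolding cH using P.one_closed by (auto)
    then show "?H \<noteq> {}" by blast
  next
    fix x assume x: "x \<in> ?H"
    then have xP: "x \<in> carrier ?P" and xc: "\<And>m n. m \<le> n \<Longrightarrow> x n mod int (p ^ m) = x m"
      by (auto simp: cH)
    have xn: "x n \<in> carrier (integer_mod_group (p ^ n))" for n
      using xP by auto
    have iv: "(inv\<^bsub>?P\<^esub> x) n = (- x n) mod int (p ^ n)" for n
      using xP xn[of n] by (simp add: inv_integer_mod_group)
    have "(inv\<^bsub>?P\<^esub> x) n mod int (p ^ m) = (inv\<^bsub>?P\<^esub> x) m" if "m \<le> n" for m n
      unfolding iv using dv[OF that] xc[OF that]
      by (simp add: mod_mod_cancel) (metis mod_minus_eq)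
    then show "inv\<^bsub>?P\<^esub> x \<in> ?H"
      using P.inv_closed[OF xP] unfolding cH by blast
  next
    fix x y assume x: "x \<in> ?H" and y: "y \<in> ?H"
    have xP: "x \<in> carrier ?P" and xc: "\<And>m n. m \<le> n \<Longrightarrow> x n mod int (p ^ m) = x m"
      using x by (auto simp: cH)
    have yP: "y \<in> carrier ?P" and yc: "\<And>m n. m \<le> n \<Longrightarrow> y n mod int (p ^ m) = y m"
      using y by (auto simp: cH)
    have ml: "(x \<otimes>\<^bsub>?P\<^esub> y) n = (x n + y n) mod int (p ^ n)" for n
      by (simp add: mult_integer_mod_group)
    have "(x \<otimes>\<^bsub>?P\<^esub> y) n mod int (p ^ m) = (x \<otimes>\<^bsub>?P\<^esub> y) m" if "m \<le> n" for m n
      unfolding ml using dv[OF that] xc[OF that] yc[OF that]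
      by (simp add: mod_mod_cancel) (metis mod_add_eq)
    then show "x \<otimes>\<^bsub>?P\<^esub> y \<in> ?H"
      using P.m_closed[OF xP yP] unfolding cH by blast
  qed
qed

lemma group_padic_int_group: "p > 0 \<Longrightarrow> group (padic_int_group p)"
  using group.subgroup_imp_group[OF _ padic_int_subgroup, of p]
  by (simp add: padic_int_group_def Let_def)


section \<open>Unramified $\mathbf{Z}_p$-coverings\<close>

definition powers :: "('g, 'x) monoid_scheme \<Rightarrow> nat \<Rightarrow> 'g set" where
  "powers \<Gamma> k = (\<lambda>g. g [^]\<^bsub>\<Gamma>\<^esub> k) ` carrier \<Gamma>"

definition layer_group :: "nat \<Rightarrow> ('g, 'x) monoid_scheme \<Rightarrow> nat \<Rightarrow> 'g set monoid" where
  "layer_group p \<Gamma> n = \<Gamma> Mod powers \<Gamma> (p ^ n)"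

definition layer_proj :: "nat \<Rightarrow> ('g, 'x) monoid_scheme \<Rightarrow> nat \<Rightarrow> 'g \<Rightarrow> 'g set" where
  "layer_proj p \<Gamma> n g = powers \<Gamma> (p ^ n) #>\<^bsub>\<Gamma>\<^esub> g"

definition voltage_assignment ::
  "('g, 'x) monoid_scheme \<Rightarrow> ('v, 'e) pre_digraph \<Rightarrow> ('e \<Rightarrow> 'e) \<Rightarrow> ('e \<Rightarrow> 'g) \<Rightarrow> bool" where
  "voltage_assignment \<Gamma> X arev \<alpha> \<longleftrightarrow>
     (\<forall>e\<in>arcs X. \<alpha> e \<in> carrier \<Gamma> \<and> \<alpha> (arev e) = inv\<^bsub>\<Gamma>\<^esub> (\<alpha> e))"

definition derived_graph ::
  "nat \<Rightarrow> ('g, 'x) monoid_scheme \<Rightarrow> ('v, 'e) pre_digraph \<Rightarrow> ('e \<Rightarrow> 'g) \<Rightarrow> nat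
     \<Rightarrow> ('g set \<times> 'v, 'g set \<times> 'e) pre_digraph" where
  "derived_graph p \<Gamma> X \<alpha> n =
     \<lparr>verts = carrier (layer_group p \<Gamma> n) \<times> verts X,
      arcs = carrier (layer_group p \<Gamma> n) \<times> arcs X,
      tail = (\<lambda>(\<gamma>, e). (\<gamma>, tail X e)),
      head = (\<lambda>(\<gamma>, e). (\<gamma> \<otimes>\<^bsub>layer_group p \<Gamma> n\<^esub> layer_proj p \<Gamma> n (\<alpha> e), head X e))\<rparr>"

definition derived_arev ::
  "nat \<Rightarrow> ('g, 'x) monoid_scheme \<Rightarrow> ('v, 'e) pre_digraph \<Rightarrow> ('e \<Rightarrow> 'e) \<Rightarrow> ('e \<Rightarrow> 'g) \<Rightarrow> nat
     \<Rightarrow> 'g set \<times> 'e \<Rightarrow> 'g set \<times> 'e" where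
  "derived_arev p \<Gamma> X arev \<alpha> n = (\<lambda>(\<gamma>, e).
     if (\<gamma>, e) \<in> arcs (derived_graph p \<Gamma> X \<alpha> n)
     then (\<gamma> \<otimes>\<^bsub>layer_group p \<Gamma> n\<^esub> layer_proj p \<Gamma> n (\<alpha> e), arev e)
     else (\<gamma>, e))"

lemma bidirected_derived_graph:
  assumes "comm_group \<Gamma>" and "bidirected_digraph X arev" and "voltage_assignment \<Gamma> X arev \<alpha>"
  shows "bidirected_digraph (derived_graph p \<Gamma> X \<alpha> n) (derived_arev p \<Gamma> X arev \<alpha> n)"
proof -
  interpret G: comm_group \<Gamma> by fact
  interpret X: bidirected_digraph X arev by fact
  let ?N = "powers \<Gamma> (p ^ n)"
  have "subgroup ?N \<Gamma>"
  proof (rule G.subgroupI)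
    fix a b assume "a \<in> ?N" "b \<in> ?N"
    then show "inv\<^bsub>\<Gamma>\<^esub> a \<in> ?N" "a \<otimes>\<^bsub>\<Gamma>\<^esub> b \<in> ?N"
      unfolding powers_def
      by (auto simp: G.nat_pow_inv[symmetric] G.nat_pow_distrib[symmetric])
  qed (auto simp: powers_def)
  then have N: "?N \<lhd> \<Gamma>" by (simp add: G.subgroup_imp_normal)
  interpret Q: group "layer_group p \<Gamma> n"
    unfolding layer_group_def using N by (rule normal.factorgroup_is_group)
  have hom: "layer_proj p \<Gamma> n \<in> hom \<Gamma> (layer_group p \<Gamma> n)"
    unfolding layer_group_def layer_proj_def[abs_def] using N by (rule normal.r_coset_hom_Mod)
  interpret h: group_hom \<Gamma> "layer_group p \<Gamma> n" "layer_proj p \<Gamma> n"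
    using hom by unfold_locales
  have v: "\<alpha> e \<in> carrier \<Gamma>" "\<alpha> (arev e) = inv\<^bsub>\<Gamma>\<^esub> (\<alpha> e)" if "e \<in> arcs X" for e
    using assms(3) that by (auto simp: voltage_assignment_def)
  interpret D: wf_digraph "derived_graph p \<Gamma> X \<alpha> n"
    by unfold_locales (auto simp: derived_graph_def v)
  show ?thesis
    by (rule D.bidirected_digraphI)
      (auto simp: derived_arev_def derived_graph_def v X.arev_neq Q.m_assoc split: if_splits)
qed

text \<open>
  Only the abstract group underlying \<open>\<Gamma>\<close> occurs: an abstract isomorphism with the $p$-adic integers
  transports the profinite topology, and the subgroups of $p^n$-th powers do not depend on it.
\<close>

locale unramified_Zp_covering =
  serre_graph X arev + \<Gamma>: group \<Gamma>
  for p :: nat and \<Gamma> :: "'g monoid"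
    and X :: "('v, 'e) pre_digraph" and arev :: "'e \<Rightarrow> 'e" and \<alpha> :: "'e \<Rightarrow> 'g" +
  assumes prime_p: "prime p"
    and iso_Zp: "\<Gamma> \<cong> padic_int_group p"
    and voltage: "voltage_assignment \<Gamma> X arev \<alpha>"
    and connected_layers: "\<And>n. Digraph_Component.connected (derived_graph p \<Gamma> X \<alpha> n)"


section \<open>Iwasawa invariants\<close>

definition layer_tree_number ::
  "nat \<Rightarrow> 'g monoid \<Rightarrow> ('v, 'e) pre_digraph \<Rightarrow> ('e \<Rightarrow> 'e) \<Rightarrow> ('e \<Rightarrow> 'g) \<Rightarrow> nat \<Rightarrow> nat" where
  "layer_tree_number p \<Gamma> X arev \<alpha> n =
     num_spanning_trees (derived_graph p \<Gamma> X \<alpha> n) (derived_arev p \<Gamma> X arev \<alpha> n)"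

text \<open>\<open>l\<close> is the $\lambda$-invariant and \<open>m\<close> the $\mu$-invariant.\<close>

definition has_iwasawa_invariants ::
  "nat \<Rightarrow> 'g monoid \<Rightarrow> ('v, 'e) pre_digraph \<Rightarrow> ('e \<Rightarrow> 'e) \<Rightarrow> ('e \<Rightarrow> 'g) \<Rightarrow> nat \<Rightarrow> nat \<Rightarrow> bool" where
  "has_iwasawa_invariants p \<Gamma> X arev \<alpha> l m \<longleftrightarrow>
     (\<exists>\<nu>::int. \<forall>\<^sub>F n in sequentially.
        int (multiplicity p (layer_tree_number p \<Gamma> X arev \<alpha> n)) = int l * int n + int m * int p ^ n + \<nu>)"

lemma iwasawa_invariants_unique:
  assumes p: "p \<ge> 2"
    and 1: "has_iwasawa_invariants p \<Gamma> X arev \<alpha> l m"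
    and 2: "has_iwasawa_invariants p \<Gamma> X arev \<alpha> l' m'"
  shows "l = l'" "m = m'"
proof -
  from 1 obtain \<nu> where 1: "\<forall>\<^sub>F n in sequentially.
      int (multiplicity p (layer_tree_number p \<Gamma> X arev \<alpha> n)) = int l * int n + int m * int p ^ n + \<nu>"
    unfolding has_iwasawa_invariants_def by blast
  from 2 obtain \<nu>' where 2: "\<forall>\<^sub>F n in sequentially.
      int (multiplicity p (layer_tree_number p \<Gamma> X arev \<alpha> n)) = int l' * int n + int m' * int p ^ n + \<nu>'"
    unfolding has_iwasawa_invariants_def by blast
  define a b c where "a = int l - int l'" and "b = int m - int m'" and "c = \<nu> - \<nu>'"
  have "\<forall>\<^sub>F n in sequentially. a * int n + b * int p ^ n + c = 0"
    using 1 2 by eventually_elim (simp add: a_def b_def c_def algebra_simps)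
  then obtain N where N: "\<And>n. n \<ge> N \<Longrightarrow> a * int n + b * int p ^ n + c = 0"
    unfolding eventually_sequentially by blast
  have e: "a * int N + b * int p ^ N + c = 0"
    "a * (int N + 1) + b * (int p * int p ^ N) + c = 0"
    "a * (int N + 2) + b * (int p * (int p * int p ^ N)) + c = 0"
    using N[of N] N[of "Suc N"] N[of "Suc (Suc N)"] by (simp_all add: algebra_simps)
  then have "b * (int p - 1)\<^sup>2 * int p ^ N = 0"
    by (simp add: power2_eq_square algebra_simps) 
  then have b: "b = 0" using p by auto
  with e have "a = 0" by (simp add: algebra_simps)
  with b show "l = l'" "m = m'" by (auto simp: a_def b_def)
qed

end

theory Submission
  imports Defs "Jordan_Normal_Form.Char_Poly" "HOL-Number_Theory.Cong"
begin

text \<open>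
  Give the bouquet \<open>X\<close> loops with integral voltages. Then \<open>X\<^sub>n\<close> is a Cayley multigraph of
  \<open>\<int>/p\<^sup>n\<close>, its Laplacian is a circulant matrix, and the eigenvalue at a root of unity \<open>z\<close> with
  \<open>z ^ (p ^ n) = 1\<close> is the sum of \<open>y\<^sub>a(z) = 2 - z ^ a - z ^ (-a)\<close> over the voltages \<open>a\<close>. The matrix-tree
  theorem turns this into \<open>bouquet_layer_tree_number\<close>: the number of spanning trees of \<open>X\<^sub>n\<close>, multiplied by
  \<open>p ^ n\<close>, is the product of these eigenvalues over \<open>z \<noteq> 1\<close>. It remains to choose the voltages so
  that the \<open>p\<close>-adic size of the product can be read off.
  
  Let \<open>l = 2 * k - 1\<close>. The function \<open>y\<^sub>1 ^ k\<close>, which up to a sign and a power of \<open>z\<close> is \<open>(1 - z) ^ (2 * k)\<close>, is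
  the combination of \<open>y\<^sub>1, \<dots>, y\<^sub>k\<close> with coefficients \<open>(-1) ^ (a + 1) * (2 * k choose (k + a))\<close>
  (\<open>one_minus_power_eq_symbols\<close>). Some of these coefficients are negative, but multiplicities of loops
  matter only modulo \<open>p\<close> for what follows: with \<open>p * (2 * k choose (k + a))\<close> added, all become positive.
  Taking every loop \<open>p ^ m\<close> times as well, the eigenvalue is \<open>p ^ m * (y\<^sub>1 ^ k + p * h)\<close>, where \<open>h\<close> is an
  integral combination of the \<open>y\<^sub>a\<close>. The voltage \<open>1\<close> occurs, so all layers are connected.
  
  Let \<open>z\<close> run through the roots of unity of exact order \<open>p ^ (n + 1)\<close>; there are
  \<open>d = p ^ (n + 1) - p ^ n\<close> of them, and the product of all \<open>1 - z\<close> is \<open>p\<close>. Each \<open>1 - z ^ i\<close> is a multiple of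
  \<open>1 - z\<close> in \<open>\<int>[z]\<close>, so \<open>p\<close> is a multiple of \<open>(1 - z) ^ d\<close>. As soon as \<open>d > 2 * k\<close>, the factor
  \<open>(1 - z) ^ (2 * k)\<close> therefore splits off from \<open>y\<^sub>1 ^ k + p * h\<close>, and what remains is a polynomial in \<open>z\<close>
  with value \<open>1\<close> or \<open>-1\<close> at \<open>z = 1\<close>. The product of the values of such a polynomial has \<open>p\<close>-adic valuation
  \<open>0\<close>, so passing from \<open>X\<^sub>n\<close> to \<open>X\<^sub>n\<^sub>+\<^sub>1\<close> raises the valuation of the number of spanning trees by exactly
  \<open>m * d + 2 * k - 1\<close> (\<open>multiplicity_tower_tree_number_Suc\<close>). Summation over \<open>n\<close> gives the invariants
  \<open>2 * k - 1 = l\<close> and \<open>m\<close>.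
\<close>

section \<open>Spanning trees as parent functions\<close>

text \<open>
  Running along an arc and later along its reverse would return to a vertex already visited. This is
  what makes the closing of a simple path by one more edge a cycle of the undirected multigraph.
\<close>

lemma (in wf_digraph) apath_no_reversed_arcs:
  assumes "apath u p v" "a \<in> set p" "b \<in> set p" "head G a = tail G b" "head G b = tail G a"
  shows False
  using assms
proof (induction p arbitrary: u a b)
  case (Cons e p)
  have path: "apath (head G e) p v" and fresh: "tail G e \<notin> set (awalk_verts (head G e) p)"
    and walk: "awalk (head G e) p v"
    using Cons.prems(1) unfolding apath_Cons_iff by (auto simp: apath_def)
  have no_loop: "head G e \<noteq> tail G e"
    using no_loops_in_apath[OF Cons.prems(1), of e] by auto
  have no_return: "head G c \<noteq> tail G e" if "c \<in> set p" for c
    using awalk_verts_arc2[OF walk that] fresh by auto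
  show ?case
    using Cons.IH[OF path] Cons.prems(2-) no_loop no_return by auto
qed simp

context serre_graph
begin

text \<open>
  A parent function assigns to every vertex an outgoing arc, or \<open>None\<close> if the vertex is a root. Arcs rather
  than neighbours are recorded because parallel edges have to be told apart.
\<close>

definition parent_choices :: "'v \<Rightarrow> 'e option set" where
  "parent_choices v = insert None (Some ` out_arcs G v)"

text \<open>
  A vertex whose parent arcs lead into a cycle is not grounded. So a parent function describes a rooted
  forest if and only if all vertices are grounded.
\<close>

inductive grounded :: "('v \<Rightarrow> 'e option) \<Rightarrow> 'v \<Rightarrow> bool" for f where
  root: "f v = None \<Longrightarrow> grounded f v"
| step: "f v = Some e \<Longrightarrow> grounded f (head G e) \<Longrightarrow> grounded f v"

definition rooted_forests :: "('v \<Rightarrow> 'e option) set" where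
  "rooted_forests = {f \<in> Pi\<^sub>E (verts G) parent_choices. \<forall>v\<in>verts G. grounded f v}"

definition roots :: "('v \<Rightarrow> 'e option) \<Rightarrow> 'v set" where
  "roots f = {v \<in> verts G. f v = None}"

definition rooted_trees :: "'v \<Rightarrow> ('v \<Rightarrow> 'e option) set" where
  "rooted_trees r = {f \<in> rooted_forests. roots f = {r}}"

definition forest_edges :: "('v \<Rightarrow> 'e option) \<Rightarrow> 'e set set" where
  "forest_edges f = {{e, arev e} | v e. v \<in> verts G \<and> f v = Some e}"

lemma finite_parent_choices: "finite (parent_choices v)"
  by (simp add: parent_choices_def finite_out_arcs)

lemma finite_rooted_forests: "finite rooted_forests"
  by (rule finite_subset[of _ "Pi\<^sub>E (verts G) parent_choices"])
    (auto simp: rooted_forests_def intro!: finite_PiE finite_parent_choices)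

lemma parent_arc:
  assumes "f \<in> Pi\<^sub>E (verts G) parent_choices" "v \<in> verts G" "f v = Some e"
  shows "e \<in> arcs G" "tail G e = v" "head G e \<in> verts G"
proof -
  have "Some e \<in> parent_choices v"
    using assms PiE_mem by metis
  then show "e \<in> arcs G" "tail G e = v" by (auto simp: parent_choices_def)
  then show "head G e \<in> verts G" by auto
qed

text \<open>
  The height of a vertex is its number of steps to the root.
\<close>

lemma grounded_height:
  assumes "\<forall>v\<in>verts G. grounded f v"
  shows "\<exists>d :: 'v \<Rightarrow> nat. \<forall>v\<in>verts G. \<forall>e. f v = Some e \<longrightarrow> d (head G e) < d v"
proof -
  define next_vertex where "next_vertex v = (case f v of None \<Rightarrow> v | Some e \<Rightarrow> head G e)" for v
  define d where "d v = (LEAST n. f ((next_vertex ^^ n) v) = None)" for v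
  have ex: "\<exists>n. f ((next_vertex ^^ n) v) = None" if "grounded f v" for v
    using that
  proof induction
    case (root v)
    then show ?case by (intro exI[of _ 0]) simp
  next
    case (step v e)
    then obtain n where "f ((next_vertex ^^ n) (head G e)) = None" by blast
    then have "f ((next_vertex ^^ Suc n) v) = None"
      using step(1) by (simp only: funpow_Suc_right comp_apply) (simp add: next_vertex_def)
    then show ?case by blast
  qed
  show ?thesis
  proof (intro exI[of _ d] ballI allI impI)
    fix v e assume v: "v \<in> verts G" and e: "f v = Some e"
    have *: "f ((next_vertex ^^ d v) v) = None"
      unfolding d_def by (rule LeastI_ex[OF ex]) (use assms v in blast)
    then obtain n where n: "d v = Suc n"
      using e by (cases "d v") auto
    have "f ((next_vertex ^^ n) (head G e)) = None"
      using * e unfolding n by (simp only: funpow_Suc_right comp_apply) (simp add: next_vertex_def)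
    then have "d (head G e) \<le> n" unfolding d_def by (rule Least_le)
    then show "d (head G e) < d v" using n by simp
  qed
qed

lemma wf_digraph_subset_arcs: "A \<subseteq> arcs G \<Longrightarrow> wf_digraph (G\<lparr>arcs := A\<rparr>)"
  by unfold_locales auto

lemma symmetric_subset_arcs:
  assumes "A \<subseteq> arcs G" "arev ` A \<subseteq> A"
  shows "symmetric (G\<lparr>arcs := A\<rparr>)"
  unfolding symmetric_def
proof (rule symI)
  fix u v assume "u \<rightarrow>\<^bsub>G\<lparr>arcs := A\<rparr>\<^esub> v"
  then obtain a where a: "a \<in> A" "tail G a = u" "head G a = v"
    by (auto simp: arcs_ends_def arc_to_ends_def)
  then have "a \<in> arcs G" "arev a \<in> A" using assms by auto
  then show "v \<rightarrow>\<^bsub>G\<lparr>arcs := A\<rparr>\<^esub> u"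
    using a by (auto simp: arcs_ends_def arc_to_ends_def intro!: rev_image_eqI[of "arev a"])
qed

lemma connected_subset_arcs_iff:
  assumes "A \<subseteq> arcs G" "arev ` A \<subseteq> A"
  shows "Digraph_Component.connected (G\<lparr>arcs := A\<rparr>) \<longleftrightarrow>
           verts G \<noteq> {} \<and> (\<forall>u\<in>verts G. \<forall>v\<in>verts G. u \<rightarrow>\<^sup>*\<^bsub>G\<lparr>arcs := A\<rparr>\<^esub> v)"
proof -
  interpret H: wf_digraph "G\<lparr>arcs := A\<rparr>" using assms(1) by (rule wf_digraph_subset_arcs)
  show ?thesis
    using H.reachable_mk_symmetric_eq[OF symmetric_subset_arcs[OF assms]]
    by (auto simp: connected_def strongly_connected_def)
qed

lemma arcs_of_undirected_edges:
  assumes "T \<subseteq> undirected_edges G arev"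
  shows "\<Union>T \<subseteq> arcs G" "arev ` \<Union>T \<subseteq> \<Union>T" "e \<in> \<Union>T \<Longrightarrow> {e, arev e} \<in> T"
  using assms by (auto simp: undirected_edges_def insert_commute dest!: subsetD)

lemma forest_edges_subset:
  assumes "f \<in> rooted_forests"
  shows "forest_edges f \<subseteq> undirected_edges G arev"
  using assms parent_arc by (fastforce simp: forest_edges_def undirected_edges_def rooted_forests_def)

lemma rooted_tree_reaches_root:
  assumes f: "f \<in> rooted_trees r" and v: "v \<in> verts G"
  shows "v \<rightarrow>\<^sup>*\<^bsub>G\<lparr>arcs := \<Union>(forest_edges f)\<rparr>\<^esub> r"
proof -
  have F: "f \<in> rooted_forests" using f by (simp add: rooted_trees_def)
  interpret H: wf_digraph "G\<lparr>arcs := \<Union>(forest_edges f)\<rparr>"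
    using arcs_of_undirected_edges(1)[OF forest_edges_subset[OF F]] by (rule wf_digraph_subset_arcs)
  have "grounded f v" using F v by (auto simp: rooted_forests_def)
  then show ?thesis using v
  proof induction
    case (root v)
    then have "v = r" using f by (auto simp: rooted_trees_def roots_def)
    then show ?case using root by auto
  next
    case (step v e)
    have "f \<in> Pi\<^sub>E (verts G) parent_choices" using F by (simp add: rooted_forests_def)
    note e = parent_arc[OF this \<open>v \<in> verts G\<close> \<open>f v = Some e\<close>]
    have e: "tail G e = v" "head G e \<in> verts G" "e \<in> \<Union>(forest_edges f)"
      using e F step by (auto simp: rooted_forests_def forest_edges_def)
    then have "v \<rightarrow>\<^bsub>G\<lparr>arcs := \<Union>(forest_edges f)\<rparr>\<^esub> head G e"
      by (force simp: arcs_ends_def arc_to_ends_def)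
    then show ?case using step.IH e(2) H.adj_reachable_trans by blast
  qed
qed

lemma rooted_tree_connected:
  assumes f: "f \<in> rooted_trees r"
  shows "Digraph_Component.connected (G\<lparr>arcs := \<Union>(forest_edges f)\<rparr>)"
proof -
  have F: "f \<in> rooted_forests" and r: "r \<in> verts G"
    using f by (auto simp: rooted_trees_def roots_def)
  note sub = arcs_of_undirected_edges[OF forest_edges_subset[OF F]]
  interpret H: wf_digraph "G\<lparr>arcs := \<Union>(forest_edges f)\<rparr>"
    using sub(1) by (rule wf_digraph_subset_arcs)
  note sym = symmetric_subset_arcs[OF sub(1,2)]
  show ?thesis
    unfolding connected_subset_arcs_iff[OF sub(1,2)]
  proof (intro conjI ballI)
    fix u v assume "u \<in> verts G" "v \<in> verts G"
    then show "u \<rightarrow>\<^sup>*\<^bsub>G\<lparr>arcs := \<Union>(forest_edges f)\<rparr>\<^esub> v"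
      using rooted_tree_reaches_root[OF f] symmetric_reachable[OF sym] H.reachable_trans by meson
  qed (use r in auto)
qed

text \<open>
  Consider a vertex of maximal height on the cycle. The parent arc of any other vertex of the cycle leads
  to a lower vertex, so the cycle can only leave the maximal vertex along its own parent arc, and it
  can only enter along the reverse of that arc; but a cycle does not use both.
\<close>

lemma forest_acyclic:
  assumes F: "f \<in> rooted_forests"
  shows "\<not> undirected_cycle (G\<lparr>arcs := \<Union>(forest_edges f)\<rparr>) arev c"
proof
  let ?H = "G\<lparr>arcs := \<Union>(forest_edges f)\<rparr>"
  assume c: "undirected_cycle ?H arev c"
  interpret H: wf_digraph ?H
    using arcs_of_undirected_edges(1)[OF forest_edges_subset[OF F]] by (rule wf_digraph_subset_arcs)
  have "\<forall>v\<in>verts G. grounded f v" using F by (simp add: rooted_forests_def)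
  from grounded_height[OF this] obtain d :: "'v \<Rightarrow> nat"
    where "\<forall>v\<in>verts G. \<forall>e. f v = Some e \<longrightarrow> d (head G e) < d v" ..
  then have d: "d (head G e) < d v" if "v \<in> verts G" "f v = Some e" for v e using that by simp
  obtain u where u: "H.awalk u c u" "c \<noteq> []"
    using c unfolding undirected_cycle_def H.cycle_def by blast
  define S where "S = tail G ` set c"
  have S_eq: "S = tail G ` set c" "S = head G ` set c"
  proof -
    have "H.cas u c u" using u(1) by (simp add: H.awalk_def)
    then have "map (tail G) c @ [head G (last c)] = tail G (hd c) # map (head G) c"
      using H.awalk_verts_conv[of u c] H.awalk_verts_conv'[of u c u] u(2) by simp
    from arg_cong[OF this, of set]
    have "insert (head G (last c)) (tail G ` set c) = insert (tail G (hd c)) (head G ` set c)"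
      by simp
    moreover have "head G (last c) = u" "tail G (hd c) = u"
      using \<open>H.cas u c u\<close> u(2) H.awlast_of_awalk[OF u(1)] H.awalk_verts_conv[of u c]
      by (auto simp: H.cas_simp)
    ultimately have *: "insert u (tail G ` set c) = insert u (head G ` set c)" by simp
    moreover have "u \<in> tail G ` set c"
      by (rule image_eqI[of _ _ "hd c"]) (simp_all add: \<open>tail G (hd c) = u\<close> u(2))
    moreover have "u \<in> head G ` set c"
      by (rule image_eqI[of _ _ "last c"]) (simp_all add: \<open>head G (last c) = u\<close> u(2))
    ultimately have "tail G ` set c = head G ` set c" by (simp add: insert_absorb)
    then show "S = tail G ` set c" "S = head G ` set c" by (simp_all add: S_def)
  qed
  have "finite S" "S \<noteq> {}" using u(2) by (auto simp: S_def)
  then have "\<exists>v\<in>S. \<forall>w\<in>S. d w \<le> d v"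
    using Max_ge[of "d ` S"] Max_in[of "d ` S"] by fastforce
  then obtain v where v: "v \<in> S" "\<And>w. w \<in> S \<Longrightarrow> d w \<le> d v" by blast
  have F': "f \<in> Pi\<^sub>E (verts G) parent_choices" using F by (simp add: rooted_forests_def)
  have arcs: "\<exists>w\<in>verts G. \<exists>e'. f w = Some e' \<and> (e = e' \<or> e = arev e')" if "e \<in> set c" for e
    
  proof -
    have "e \<in> \<Union>(forest_edges f)" using u(1) that unfolding H.awalk_def by auto
    then show ?thesis unfolding forest_edges_def by blast
  qed

  obtain a where a: "a \<in> set c" "tail G a = v" using v(1) unfolding S_eq(1) by blast
  have out: "f v = Some a"
  proof -
    obtain w e where w: "w \<in> verts G" "f w = Some e" "a = e \<or> a = arev e" using arcs[OF a(1)] by blast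
    note e = parent_arc[OF F' w(1,2)]
    show ?thesis
    proof (cases "a = e")
      case False
      then have "head G e = v" "head G a = w" using w(3) a(2) e by auto
      moreover have "head G a \<in> S" using a(1) S_eq(2) by blast
      ultimately show ?thesis using d[OF w(1,2)] v(2)[of w] by simp
    next
      case True
      then have "w = v" using e(2) a(2) by simp
      then show ?thesis using w(2) True by simp
    qed
  qed
  obtain b where b: "b \<in> set c" "head G b = v" using v(1) unfolding S_eq(2) by blast
  obtain w e where w: "w \<in> verts G" "f w = Some e" "b = e \<or> b = arev e" using arcs[OF b(1)] by blast
  note e = parent_arc[OF F' w(1,2)]
  have "b = arev a"
  proof (cases "b = e")
    case True
    then have "tail G b = w" using e(2) by simp
    moreover have "tail G b \<in> S" using b(1) S_eq(1) by blast
    ultimately show ?thesis using d[OF w(1,2)] v(2)[of w] b(2) True by simp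
  next
    case False
    then have b_eq: "b = arev e" using w(3) by simp
    then have "w = v" using b(2) e(1,2) by simp
    then show ?thesis using out w(2) b_eq by simp
  qed
  then show False using c a(1) b(1) unfolding undirected_cycle_def by blast
qed


text \<open>
  Equality of the parent functions propagates from the root to the vertices above it. If \<open>e\<close> is the \<open>f\<close>-parent
  arc of \<open>v\<close>, then its edge comes from some \<open>g\<close>-parent arc, which is either \<open>e\<close> itself or the reverse of
  \<open>e\<close> at the vertex \<open>head G e\<close>, where \<open>f\<close> and \<open>g\<close> already agree.
\<close>

lemma forest_edges_inj:
  assumes f: "f \<in> rooted_trees r" and g: "g \<in> rooted_trees r"
    and eq: "forest_edges f = forest_edges g"
  shows "f = g"
proof -
  have F: "f \<in> Pi\<^sub>E (verts G) parent_choices" "g \<in> Pi\<^sub>E (verts G) parent_choices"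
    "\<forall>v\<in>verts G. grounded f v"
    and R: "roots f = {r}" "roots g = {r}"
    using f g by (auto simp: rooted_trees_def rooted_forests_def)
  from grounded_height[OF F(3)] obtain d :: "'v \<Rightarrow> nat"
    where "\<forall>v\<in>verts G. \<forall>e. f v = Some e \<longrightarrow> d (head G e) < d v" ..
  then have d: "d (head G e) < d v" if "v \<in> verts G" "f v = Some e" for v e using that by simp
  have "f v = g v" if "v \<in> verts G" for v
  proof -
    have "grounded f v" using F(3) that by simp
    then show ?thesis using that
    proof induction
      case (root v)
      then have "v \<in> roots g" using R unfolding roots_def by blast
      then show ?case using root.hyps by (simp add: roots_def)
    next
      case (step v e)
      note e = parent_arc[OF F(1) step.prems step.hyps(1)]
      have IH: "f (head G e) = g (head G e)" using step.IH[OF e(3)] .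
      have "{e, arev e} \<in> forest_edges g"
        unfolding eq[symmetric] unfolding forest_edges_def
        by (intro CollectI exI[of _ v] exI[of _ e] conjI refl step.prems step.hyps(1))
      then have "\<exists>w e'. {e, arev e} = {e', arev e'} \<and> w \<in> verts G \<and> g w = Some e'"
        unfolding forest_edges_def by (rule CollectD)
      then obtain w e' where w: "w \<in> verts G" "g w = Some e'" "{e, arev e} = {e', arev e'}"
        by (elim exE conjE) (rule that)
      note e' = parent_arc[OF F(2) w(1,2)]
      show ?case
      proof (cases "e' = e")
        case True
        then have "w = v" using e'(2) e(2) by simp
        have "g v = Some e" using w(2) unfolding \<open>w = v\<close> True .
        then show ?thesis using step.hyps(1) by simp
      next
        case False
        then have e'_eq: "e' = arev e" using w(3) by (simp add: doubleton_eq_iff)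
        then have "w = head G e" using e'(2) e(1) by simp
        then have "f w = Some e'" using IH w by simp
        \<comment> \<open>Then \<open>f\<close> would run along \<open>e\<close> and straight back, for ever.\<close>
        then have "d (head G e') < d w" using d w(1) by blast
        moreover have "d w < d v" using d[OF step.prems step.hyps(1)] \<open>w = head G e\<close> by simp
        moreover have "head G e' = v" using e'_eq e(1,2) by simp
        ultimately show ?thesis by simp
      qed
    qed
  qed
  then show ?thesis by (rule PiE_ext[OF F(1,2)])
qed

text \<open>
  Let the parent arc of \<open>v\<close> be the first arc of a shortest path to \<open>r\<close> within the tree. These arcs
  already connect all vertices, so any further edge of the tree would close a cycle.
\<close>

lemma spanning_tree_is_forest_edges:
  assumes T: "T \<in> spanning_trees G arev" and r: "r \<in> verts G"
  shows "T \<in> forest_edges ` rooted_trees r"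
proof -
  let ?H = "G\<lparr>arcs := \<Union>T\<rparr>"
  have sub: "T \<subseteq> undirected_edges G arev" and conn: "Digraph_Component.connected ?H"
    and acyc: "\<And>c. \<not> undirected_cycle ?H arev c"
    using T by (auto simp: spanning_trees_def undirected_tree_def)
  note T_arcs = arcs_of_undirected_edges[OF sub]
  interpret H: wf_digraph ?H using T_arcs(1) by (rule wf_digraph_subset_arcs)
  define d where "d v = (LEAST n. \<exists>p. H.awalk v p r \<and> length p = n)" for v
  have walk: "\<exists>p. H.awalk v p r \<and> length p = d v" if "v \<in> verts G" for v
  proof -
    have "v \<rightarrow>\<^sup>*\<^bsub>?H\<^esub> r"
      using conn that r unfolding connected_subset_arcs_iff[OF T_arcs(1,2)] by simp
    then obtain p where "H.awalk v p r" unfolding H.reachable_awalk ..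
    then have "\<exists>n p. H.awalk v p r \<and> length p = n" by blast
    then show ?thesis unfolding d_def by (rule LeastI_ex)
  qed
  have ex: "\<exists>e. e \<in> \<Union>T \<and> tail G e = v \<and> d (head G e) < d v"
    if v: "v \<in> verts G" "v \<noteq> r" for v
  proof -
    obtain p where p: "H.awalk v p r" "length p = d v"
      using walk[OF v(1)] by (elim exE conjE)
    have "p \<noteq> []"
    proof
      assume "p = []"
      then have "H.cas v [] r" using p(1) unfolding H.awalk_def by simp
      then show False using v(2) unfolding H.cas.simps by simp
    qed
    then obtain e q where q: "p = e # q" by (meson neq_Nil_conv)
    have e: "H.awalk (head G e) q r" "e \<in> \<Union>T" "tail G e = v"
      using p(1) unfolding q H.awalk_Cons_iff by simp_all
    have "d (head G e) \<le> length q" unfolding d_def by (rule Least_le) (use e(1) in blast)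
    then have "d (head G e) < d v" using p(2) q by simp
    then show ?thesis using e(2,3) by blast
  qed
  then have "\<forall>v\<in>verts G - {r}. \<exists>e. e \<in> \<Union>T \<and> tail G e = v \<and> d (head G e) < d v" by blast
  from bchoice[OF this] obtain par
    where "\<forall>v\<in>verts G - {r}. par v \<in> \<Union>T \<and> tail G (par v) = v \<and> d (head G (par v)) < d v" ..
  then have par: "par v \<in> \<Union>T" "tail G (par v) = v" "d (head G (par v)) < d v"
    if "v \<in> verts G" "v \<noteq> r" for v using that by auto
  define f where "f = (\<lambda>v\<in>verts G. if v = r then None else Some (par v))"
  have f_Some: "f v = Some e \<longleftrightarrow> e = par v \<and> v \<noteq> r" if "v \<in> verts G" for v e
    using that by (auto simp: f_def)
  have par_arc: "par v \<in> arcs G" if "v \<in> verts G" "v \<noteq> r" for v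
    using par(1)[OF that] T_arcs(1) by blast
  have F: "f \<in> Pi\<^sub>E (verts G) parent_choices"
  proof (rule PiE_I)
    fix v assume "v \<in> verts G"
    then show "f v \<in> parent_choices v"
      using par_arc[of v] par(2)[of v] by (auto simp: f_def parent_choices_def)
  qed (simp add: f_def)
  have gr: "grounded f v" if "v \<in> verts G" for v
    using that
  proof (induction "d v" arbitrary: v rule: less_induct)
    case less
    show ?case
    proof (cases "v = r")
      case True
      then show ?thesis using less by (intro grounded.root) (simp add: f_def)
    next
      case False
      show ?thesis
      proof (rule grounded.step)
        show "f v = Some (par v)" using less False by (simp add: f_Some)
        show "grounded f (head G (par v))"
          using par_arc[OF less.prems False] less.hyps[OF par(3)[OF less.prems False]] by simp
      qed
    qed
  qed
  have f: "f \<in> rooted_trees r"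
    using F gr r by (auto simp: rooted_trees_def rooted_forests_def roots_def f_def)
  then have FF: "f \<in> rooted_forests" by (simp add: rooted_trees_def)
  have fT: "forest_edges f \<subseteq> T"
  proof
    fix E assume "E \<in> forest_edges f"
    then obtain v where "v \<in> verts G" "v \<noteq> r" "E = {par v, arev (par v)}"
      by (auto simp: forest_edges_def f_Some)
    then show "E \<in> T" using T_arcs(3)[OF par(1)] by simp
  qed
  moreover have "T \<subseteq> forest_edges f"
  proof (rule ccontr)
    assume "\<not> T \<subseteq> forest_edges f"
    then obtain E where E: "E \<in> T" "E \<notin> forest_edges f" by blast
    then obtain e where e: "E = {e, arev e}" "e \<in> arcs G" using sub by (auto simp: undirected_edges_def)
    have unused: "e \<notin> \<Union>(forest_edges f)" "arev e \<notin> \<Union>(forest_edges f)"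
      using E(2) arcs_of_undirected_edges(3)[OF forest_edges_subset[OF FF], of e]
        arcs_of_undirected_edges(3)[OF forest_edges_subset[OF FF], of "arev e"]
      unfolding e(1) by (auto simp: insert_commute)
    let ?K = "G\<lparr>arcs := \<Union>(forest_edges f)\<rparr>"
    note K_arcs = arcs_of_undirected_edges[OF forest_edges_subset[OF FF]]
    interpret K: wf_digraph ?K using K_arcs(1) by (rule wf_digraph_subset_arcs)
    have "head G e \<rightarrow>\<^sup>*\<^bsub>?K\<^esub> tail G e"
      using rooted_tree_connected[OF f] e(2) connected_subset_arcs_iff[OF K_arcs(1,2)] by auto
    then obtain p where p: "K.apath (head G e) p (tail G e)" by (auto simp: K.reachable_apath)
    then have pK: "set p \<subseteq> \<Union>(forest_edges f)" by (auto simp: K.apath_def K.awalk_def)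
    have no_rev: "arev a \<notin> set p" if a: "a \<in> set p" for a
    proof
      assume b: "arev a \<in> set p"
      have "a \<in> arcs G" using a pK K_arcs(1) by blast
      then show False using K.apath_no_reversed_arcs[OF p a b] by simp
    qed
    have cas_eq: "pre_digraph.cas ?K u q v = pre_digraph.cas ?H u q v" for u q v
      by (induction q arbitrary: u) (simp_all add: K.cas.simps H.cas.simps)
    have verts_eq: "pre_digraph.awalk_verts ?K u q = pre_digraph.awalk_verts ?H u q" for u q
      by (simp add: K.awalk_verts_conv H.awalk_verts_conv)
    have pT: "set p \<subseteq> \<Union>T" using pK fT by blast
    have walk: "H.awalk (head G e) p (tail G e)"
      using p pT unfolding K.apath_def K.awalk_def H.awalk_def cas_eq by simp
    have dist: "distinct (H.awalk_verts (head G e) p)"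
      using p unfolding K.apath_def verts_eq by simp
    have "e \<in> \<Union>T" using E(1) e(1) by blast
    then have "H.awalk (tail G e) (e # p) (tail G e)"
      using walk unfolding H.awalk_Cons_iff by simp
    then have "H.cycle (e # p)"
      using dist unfolding H.cycle_def by (intro exI[of _ "tail G e"]) simp
    moreover have "\<forall>a\<in>set (e # p). arev a \<notin> set (e # p)"
    proof
      fix a assume a: "a \<in> set (e # p)"
      show "arev a \<notin> set (e # p)"
      proof (cases "a = e")
        case True
        then show ?thesis using unused(2) pK arev_neq[OF e(2)] by auto
      next
        case False
        then have "a \<in> set p" using a by simp
        moreover from this have "arev a \<noteq> e" using unused(2) pK by auto
        ultimately show ?thesis using no_rev by simp
      qed
    qed
    ultimately show False using acyc unfolding undirected_cycle_def by blast
  qed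
  ultimately have "T = forest_edges f" by (rule equalityI[rotated])
  then show ?thesis using f by (rule image_eqI)
qed

lemma card_rooted_trees:
  assumes "r \<in> verts G"
  shows "card (rooted_trees r) = num_spanning_trees G arev"
proof -
  have "forest_edges f \<in> spanning_trees G arev" if f: "f \<in> rooted_trees r" for f
  proof -
    have "f \<in> rooted_forests" using f by (simp add: rooted_trees_def)
    then show ?thesis
      using forest_edges_subset forest_acyclic rooted_tree_connected[OF f]
      by (auto simp: spanning_trees_def undirected_tree_def)
  qed
  then have "bij_betw forest_edges (rooted_trees r) (spanning_trees G arev)"
    unfolding bij_betw_def
    using spanning_tree_is_forest_edges[OF _ assms] forest_edges_inj[of _ r]
    by (intro conjI equalityI subsetI inj_onI) blast+
  then show ?thesis by (simp add: num_spanning_trees_def bij_betw_same_card)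
qed

end

section \<open>The matrix-tree theorem\<close>

lemma det_mat_eq_sum_permutations:
  "det (mat N N (\<lambda>(i, j). M i j)) =
     (\<Sum>\<sigma> | \<sigma> permutes {0..<N}. signof \<sigma> * (\<Prod>i = 0..<N. M i (\<sigma> i)))"
proof -
  have "(\<Prod>i = 0..<N. mat N N (\<lambda>(i, j). M i j) $$ (i, \<sigma> i)) = (\<Prod>i = 0..<N. M i (\<sigma> i))"
    if "\<sigma> permutes {0..<N}" for \<sigma>
    using permutes_in_image[OF that] by (intro prod.cong) auto
  then show ?thesis by (subst det_def'[of _ N]) auto
qed

lemma det_scale_rows:
  "det (mat N N (\<lambda>(i, j). c i * M i j)) = (\<Prod>i = 0..<N. c i) * det (mat N N (\<lambda>(i, j). M i j))"
  unfolding det_mat_eq_sum_permutations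
  by (simp add: prod.distrib sum_distrib_left mult.left_commute)

text \<open>
  Multilinearity of the determinant in all rows at once.
\<close>

lemma det_row_sums:
  assumes vs: "bij_betw vs {0..<N} V" and fin: "\<And>v. v \<in> V \<Longrightarrow> finite (C v)"
  shows "det (mat N N (\<lambda>(i, j). \<Sum>c\<in>C (vs i). B (vs i) c (vs j))) =
           (\<Sum>f\<in>Pi\<^sub>E V C. det (mat N N (\<lambda>(i, j). B (vs i) (f (vs i)) (vs j))))"
proof -
  have finV: "finite V" using vs bij_betw_finite by blast
  define ix where "ix = the_inv_into {0..<N} vs"
  have ix: "ix (vs i) = i" if "i < N" for i
    using that vs unfolding ix_def bij_betw_def by (auto intro: the_inv_into_f_f)
  have over_V: "(\<Prod>i = 0..<N. h (vs i) i) = (\<Prod>v\<in>V. h v (ix v))" for h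

    by (subst prod.reindex_bij_betw[OF vs, symmetric]) (simp add: ix)
  have "(\<Prod>i = 0..<N. \<Sum>c\<in>C (vs i). B (vs i) c (vs (\<sigma> i))) =
          (\<Sum>f\<in>Pi\<^sub>E V C. \<Prod>i = 0..<N. B (vs i) (f (vs i)) (vs (\<sigma> i)))" for \<sigma>
  proof -
    have "(\<Prod>i = 0..<N. \<Sum>c\<in>C (vs i). B (vs i) c (vs (\<sigma> i))) =
            (\<Prod>v\<in>V. \<Sum>c\<in>C v. B v c (vs (\<sigma> (ix v))))"
      by (rule over_V)
    also have "\<dots> = (\<Sum>f\<in>Pi\<^sub>E V C. \<Prod>v\<in>V. B v (f v) (vs (\<sigma> (ix v))))"
      by (rule prod_sum_PiE) (use finV fin in auto)
    also have "\<dots> = (\<Sum>f\<in>Pi\<^sub>E V C. \<Prod>i = 0..<N. B (vs i) (f (vs i)) (vs (\<sigma> i)))"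
      by (intro sum.cong refl over_V[symmetric])
    finally show ?thesis .
  qed
  then show ?thesis
    unfolding det_mat_eq_sum_permutations
    by (simp add: sum_distrib_left) (rule sum.swap)
qed

context serre_graph
begin

lemma rooted_forest_has_root:
  assumes f: "f \<in> rooted_forests" and "verts G \<noteq> {}"
  shows "roots f \<noteq> {}"
proof -
  have F: "f \<in> Pi\<^sub>E (verts G) parent_choices" using f by (simp add: rooted_forests_def)
  have "roots f \<noteq> {}" if "grounded f v" "v \<in> verts G" for v
    using that
  proof induction
    case (root v)
    then show ?case unfolding roots_def by blast
  next
    case (step v e)
    then show ?case using parent_arc(3)[OF F] by simp
  qed
  then show ?thesis using f assms(2) by (auto simp: rooted_forests_def)
qed

text \<open>
  The matrix is the identity minus the incidence of the parent function. If every vertex is grounded, a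
  permutation contributing to the determinant moves each vertex to itself or to its parent, hence fixes
  all vertices, by induction from the roots. If some vertices are not grounded, the indicator
  function of the set of these vertices is in the kernel, because a vertex belongs to this set if and
  only if it has a parent that does.
\<close>

lemma det_parent_matrix:
  assumes vs: "bij_betw vs {0..<N} (verts G)" and F: "f \<in> Pi\<^sub>E (verts G) parent_choices"
  shows "det (mat N N (\<lambda>(i, j). of_bool (vs i = vs j) -
             (case f (vs i) of None \<Rightarrow> 0 | Some e \<Rightarrow> of_bool (vs j = head G e)))) =
         (of_bool (\<forall>v\<in>verts G. grounded f v) :: 'a :: idom)"
    (is "det (mat N N (\<lambda>(i, j). ?M i j)) = _")
proof -
  have V: "vs i \<in> verts G" if "i < N" for i using vs that by (auto simp: bij_betw_def)
  have inj: "vs i = vs j \<longleftrightarrow> i = j" if "i < N" "j < N" for i j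
    using vs that by (auto simp: bij_betw_def inj_on_def)
  show ?thesis
  proof (cases "\<forall>v\<in>verts G. grounded f v")
    case True
    have off_diagonal: "(\<Prod>i = 0..<N. ?M i (\<sigma> i)) = (0 :: 'a)" if \<sigma>: "\<sigma> permutes {0..<N}" and "\<sigma> \<noteq> id" for \<sigma>
    proof (rule ccontr)
      assume "(\<Prod>i = 0..<N. ?M i (\<sigma> i)) \<noteq> (0 :: 'a)"
      then have nz: "?M i (\<sigma> i) \<noteq> (0 :: 'a)" if "i < N" for i
        using that by (metis (no_types, lifting) atLeastLessThan_iff finite_atLeastLessThan prod_zero zero_le)
      have \<sigma>N: "\<sigma> i < N" if "i < N" for i using permutes_in_image[OF \<sigma>, of i] that by simp
      have "\<forall>i<N. vs i = v \<longrightarrow> \<sigma> i = i" if "v \<in> verts G" for v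
      proof -
        have "grounded f v" using True that by simp
        then show ?thesis using that
        proof induction
          case (root v)
          show ?case
          proof (intro allI impI)
            fix i assume i: "i < N" "vs i = v"
            then show "\<sigma> i = i" using nz[OF i(1)] root.hyps inj[OF i(1) \<sigma>N[OF i(1)]]
              by (auto split: if_splits)
          qed
        next
          case (step v e)
          have hd: "head G e \<in> verts G" by (rule parent_arc(3)[OF F step.prems step.hyps(1)])
          show ?case
          proof (intro allI impI)
            fix i assume i: "i < N" "vs i = v"
            have j: "\<sigma> i < N" using \<sigma>N i by simp
            show "\<sigma> i = i"
            proof (rule ccontr)
              assume ne: "\<sigma> i \<noteq> i"
              then have "vs (\<sigma> i) = head G e"
                using nz[OF i(1)] i(2) step.hyps(1) inj[OF i(1) j] by (auto split: if_splits)
              then have "\<sigma> (\<sigma> i) = \<sigma> i" using step.IH[OF hd] j by simp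
              then show False using ne permutes_inj[OF \<sigma>] by (meson injD)
            qed
          qed
        qed
      qed
      then have "\<sigma> i = i" for i using V permutes_not_in[OF \<sigma>, of i] by (cases "i < N") auto
      then show False using \<open>\<sigma> \<noteq> id\<close> by auto
    qed
    have "?M i i = (1 :: 'a)" if "i < N" for i
    proof (cases "f (vs i)")
      case (Some e)
      obtain d :: "'v \<Rightarrow> nat"
        where d: "\<forall>v\<in>verts G. \<forall>e. f v = Some e \<longrightarrow> d (head G e) < d v"
        using grounded_height[OF True] ..
      then have "d (head G e) < d (vs i)" using V[OF that] Some by simp
      then have "vs i \<noteq> head G e" by auto
      then show ?thesis using Some by simp
    qed simp
    then have diagonal: "(\<Prod>i = 0..<N. ?M i i) = (1 :: 'a)" by (intro prod.neutral) auto
    have "signof \<sigma> * (\<Prod>i = 0..<N. ?M i (\<sigma> i)) = (if \<sigma> = id then 1 else (0 :: 'a))"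
      if "\<sigma> permutes {0..<N}" for \<sigma>
    proof (cases "\<sigma> = id")
      case True
      then show ?thesis using diagonal by (simp only: id_apply) simp
    next
      case False
      then show ?thesis using off_diagonal[OF that] by simp
    qed
    then have "det (mat N N (\<lambda>(i, j). ?M i j)) = (\<Sum>\<sigma> | \<sigma> permutes {0..<N}. if \<sigma> = id then 1 else (0 :: 'a))"
      unfolding det_mat_eq_sum_permutations by (intro sum.cong) auto
    also have "\<dots> = 1" by (subst sum.delta) (auto simp: finite_permutations permutes_id)
    finally show ?thesis using True by simp
  next
    case False
    define x :: "'a vec" where "x = vec N (\<lambda>i. of_bool (\<not> grounded f (vs i)))"
    let ?A = "mat N N (\<lambda>(i, j). ?M i j) :: 'a mat"
    have over_V: "(\<Sum>j = 0..<N. h (vs j)) = (\<Sum>v\<in>verts G. h v)" for h :: "'v \<Rightarrow> 'a"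
      by (rule sum.reindex_bij_betw[OF vs])
    have step: "grounded f v \<longleftrightarrow> (case f v of None \<Rightarrow> True | Some e \<Rightarrow> grounded f (head G e))" for v
      by (subst grounded.simps) (auto split: option.splits)
    have "?A *\<^sub>v x = 0\<^sub>v N"
    proof (rule eq_vecI)
      fix i assume "i < dim_vec (0\<^sub>v N :: 'a vec)"
      then have i: "i < N" by simp
      let ?h = "\<lambda>v. (of_bool (vs i = v) - (case f (vs i) of None \<Rightarrow> 0 | Some e \<Rightarrow> of_bool (v = head G e))) *
                    of_bool (\<not> grounded f v) :: 'a"
      have "(?A *\<^sub>v x) $ i = (\<Sum>j = 0..<N. ?h (vs j))"
        using i by (simp add: x_def scalar_prod_def)
      also have "\<dots> = (\<Sum>v\<in>verts G. ?h v)" by (rule over_V)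
      also have "\<dots> = of_bool (\<not> grounded f (vs i)) -
          (\<Sum>v\<in>verts G. (case f (vs i) of None \<Rightarrow> 0 | Some e \<Rightarrow> of_bool (v = head G e)) * of_bool (\<not> grounded f v))"
        using V[OF i] by (simp add: left_diff_distrib sum_subtractf of_bool_def if_distrib[of "\<lambda>x. x * _"] cong: if_cong)
      also have "\<dots> = 0"
      proof (cases "f (vs i)")
        case None
        then show ?thesis using step[of "vs i"] by simp
      next
        case (Some e)
        have "head G e \<in> verts G" by (rule parent_arc(3)[OF F V[OF i] Some])
        then show ?thesis using step[of "vs i"] Some
          by (simp add: of_bool_def if_distrib[of "\<lambda>x. x * _"] cong: if_cong)
      qed
      finally show "(?A *\<^sub>v x) $ i = 0\<^sub>v N $ i" using i by simp
    qed simp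
    moreover have "x \<noteq> 0\<^sub>v N"
    proof
      assume x0: "x = 0\<^sub>v N"
      obtain v where "v \<in> verts G" "\<not> grounded f v" using False by blast
      then obtain i where "i < N" "vs i = v"
        using vs unfolding bij_betw_def by (metis atLeastLessThan_iff imageE)
      then show False using arg_cong[OF x0, of "\<lambda>x. x $ i"] \<open>\<not> grounded f v\<close> by (simp add: x_def)
    qed
    moreover have "x \<in> carrier_vec N" by (simp add: x_def)
    ultimately have "det ?A = 0" by (subst det_0_iff_vec_prod_zero[of _ N]) auto
    then show ?thesis using False by simp
  qed
qed

text \<open>
  The shift by \<open>s\<close> provides in each row one more summand, the choice of being a root. So the rows split
  into parent choices, and only the forests survive. Working with a shift instead of a deleted row keeps
  the matrix circulant when the graph is a Cayley graph.
\<close>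

theorem det_shifted_laplacian:
  fixes s :: "'a :: idom"
  assumes vs: "bij_betw vs {0..<N} (verts G)"
  shows "det (mat N N (\<lambda>(i, j). s * of_bool (i = j) +
             (\<Sum>e\<in>out_arcs G (vs i). of_bool (i = j) - of_bool (vs j = head G e)))) =
         (\<Sum>f\<in>rooted_forests. s ^ card (roots f))"
proof -
  define B where "B u c w = (case c of None \<Rightarrow> s | Some e \<Rightarrow> 1) *
    (of_bool (u = w) - (case c of None \<Rightarrow> 0 | Some e \<Rightarrow> of_bool (w = head G e)))" for u c w
  have inj: "vs i = vs j \<longleftrightarrow> i = j" if "i < N" "j < N" for i j
    using vs that by (auto simp: bij_betw_def inj_on_def)
  have rows: "s * of_bool (i = j) +
             (\<Sum>e\<in>out_arcs G (vs i). of_bool (i = j) - of_bool (vs j = head G e)) =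
           (\<Sum>c\<in>parent_choices (vs i). B (vs i) c (vs j))" if "i < N" "j < N" for i j
    unfolding parent_choices_def using finite_out_arcs[of "vs i"] inj[OF that]
    by (simp add: B_def sum.reindex image_iff)
  have scale: "(\<Prod>i = 0..<N. case f (vs i) of None \<Rightarrow> s | Some e \<Rightarrow> 1) = s ^ card (roots f)" for f
  proof -
    have "(\<Prod>i = 0..<N. case f (vs i) of None \<Rightarrow> s | Some e \<Rightarrow> 1) =
        (\<Prod>v\<in>verts G. case f v of None \<Rightarrow> s | Some e \<Rightarrow> 1)"
      by (rule prod.reindex_bij_betw[OF vs])
    also have "\<dots> = (\<Prod>v\<in>verts G. if f v = None then s else 1)"
      by (intro prod.cong) (auto split: option.splits)
    also have "\<dots> = s ^ card (roots f)"
      by (simp add: prod.inter_filter[symmetric] roots_def)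
    finally show ?thesis .
  qed
  have "det (mat N N (\<lambda>(i, j). s * of_bool (i = j) +
             (\<Sum>e\<in>out_arcs G (vs i). of_bool (i = j) - of_bool (vs j = head G e)))) =
        det (mat N N (\<lambda>(i, j). \<Sum>c\<in>parent_choices (vs i). B (vs i) c (vs j)))"
    by (intro arg_cong[of _ _ det] eq_matI) (simp_all add: rows)
  also have "\<dots> = (\<Sum>f\<in>Pi\<^sub>E (verts G) parent_choices. det (mat N N (\<lambda>(i, j). B (vs i) (f (vs i)) (vs j))))"
    by (rule det_row_sums[OF vs]) (rule finite_parent_choices)
  also have "\<dots> = (\<Sum>f\<in>Pi\<^sub>E (verts G) parent_choices.
      s ^ card (roots f) * of_bool (\<forall>v\<in>verts G. grounded f v))"
    unfolding B_def by (intro sum.cong refl) (simp only: det_scale_rows scale det_parent_matrix[OF vs])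
  also have "\<dots> = (\<Sum>f\<in>rooted_forests. s ^ card (roots f))"
  proof -
    have "finite (Pi\<^sub>E (verts G) parent_choices)" by (intro finite_PiE finite_parent_choices) simp
    then show ?thesis
      unfolding rooted_forests_def
      by (simp add: of_bool_def if_distrib[of "\<lambda>x. _ * x"] sum.inter_filter cong: if_cong)
  qed
  finally show ?thesis .
qed

text \<open>
  The coefficient of \<open>s\<close> counts the forests with a single root, that is, pairs of a spanning tree
  and a vertex.
\<close>

lemma rooted_forest_polynomial:
  fixes s :: "'a :: comm_ring_1"
  assumes "verts G \<noteq> {}"
  shows "(\<Sum>f\<in>rooted_forests. s ^ card (roots f)) =
           s * of_nat (card (verts G) * num_spanning_trees G arev) +
           s\<^sup>2 * (\<Sum>f | f \<in> rooted_forests \<and> 2 \<le> card (roots f). s ^ (card (roots f) - 2))"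
proof -
  define A B where "A = {f \<in> rooted_forests. card (roots f) = 1}"
    and "B = {f \<in> rooted_forests. 2 \<le> card (roots f)}"
  have fin: "finite A" "finite B" using finite_rooted_forests by (auto simp: A_def B_def)
  have "card (roots f) \<noteq> 0" if "f \<in> rooted_forests" for f
  proof -
    have "finite (roots f)" by (simp add: roots_def)
    then show ?thesis using rooted_forest_has_root[OF that assms] by simp
  qed
  then have AB: "rooted_forests = A \<union> B" "A \<inter> B = {}"
    by (fastforce simp: A_def B_def)+
  have A_eq: "A = (\<Union>r\<in>verts G. rooted_trees r)"
    by (auto simp: A_def rooted_trees_def card_1_singleton_iff roots_def)
  have "card A = (\<Sum>r\<in>verts G. card (rooted_trees r))"
    unfolding A_eq
  proof (rule card_UN_disjoint)
    show "\<forall>r\<in>verts G. finite (rooted_trees r)"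
      using finite_rooted_forests by (auto simp: rooted_trees_def)
  qed (auto simp: rooted_trees_def)
  also have "\<dots> = card (verts G) * num_spanning_trees G arev" by (simp add: card_rooted_trees)
  finally have card_A: "card A = card (verts G) * num_spanning_trees G arev" .
  have "(\<Sum>f\<in>rooted_forests. s ^ card (roots f)) = (\<Sum>f\<in>A. s ^ card (roots f)) + (\<Sum>f\<in>B. s ^ card (roots f))"
    unfolding AB(1) by (rule sum.union_disjoint[OF fin AB(2)])
  also have "(\<Sum>f\<in>A. s ^ card (roots f)) = s * of_nat (card A)"
    by (simp add: A_def)
  also have "(\<Sum>f\<in>B. s ^ card (roots f)) = (\<Sum>f\<in>B. s\<^sup>2 * s ^ (card (roots f) - 2))"
  proof (intro sum.cong refl)
    fix f assume "f \<in> B"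
    then have "2 \<le> card (roots f)" by (simp add: B_def)
    then have "card (roots f) = 2 + (card (roots f) - 2)" by arith
    then show "s ^ card (roots f) = s\<^sup>2 * s ^ (card (roots f) - 2)" by (metis power_add)
  qed
  finally show ?thesis unfolding card_A B_def sum_distrib_left .
qed

end

section \<open>Circulant determinants\<close>

abbreviation unity_roots :: "nat \<Rightarrow> complex set" where
  "unity_roots N \<equiv> {z. z ^ N = 1}"

lemma power_int_mod_unity_root:
  fixes z :: complex
  assumes "z ^ N = 1" "N > 0"
  shows "z powi (m mod int N) = z powi m"
proof -
  have "z \<noteq> 0" using assms by (auto simp: power_0_left split: if_splits)
  have "z powi m = z powi (int N * (m div int N) + m mod int N)" by simp
  also have "\<dots> = (z powi int N) powi (m div int N) * z powi (m mod int N)"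
    using \<open>z \<noteq> 0\<close> by (simp only: power_int_add power_int_mult simp_thms)
  also have "\<dots> = z powi (m mod int N)" using assms(1) by simp
  finally show ?thesis by simp
qed

text \<open>
  The circulant matrix of the element of the group ring of \<open>\<int>/N\<close> in which \<open>a e\<close> has the weight \<open>w e\<close>,
  summed over \<open>e\<close>. Several \<open>e\<close> may have the same \<open>a e\<close>, as parallel arcs do.
\<close>

definition circulant :: "nat \<Rightarrow> 'e set \<Rightarrow> ('e \<Rightarrow> int) \<Rightarrow> ('e \<Rightarrow> 'a :: comm_ring_1) \<Rightarrow> 'a mat" where
  "circulant N E a w =
     mat N N (\<lambda>(i, j). \<Sum>e\<in>E. w e * of_bool ((int i + a e) mod int N = int j))"

text \<open>
  The vectors \<open>(1, z, z\<^sup>2, \<dots>)\<close>, for the \<open>N\<close>-th roots of unity \<open>z\<close>, are eigenvectors. They form the columns of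
  the Fourier matrix \<open>F\<close>, which is invertible since \<open>F' * F\<close> is \<open>N\<close> times the identity.
\<close>

theorem det_circulant:
  fixes w :: "'e \<Rightarrow> complex"
  assumes "N > 0" "finite E"
  shows "det (circulant N E a w) = (\<Prod>z\<in>unity_roots N. \<Sum>e\<in>E. w e * z powi a e)"
proof -
  define root where "root k = cis (2 * pi * real k / real N)" for k
  have bij: "bij_betw root {0..<N} (unity_roots N)"
    unfolding root_def using bij_betw_roots_unity[OF \<open>N > 0\<close>] by (simp add: atLeast0LessThan)
  have root: "root k ^ N = 1" if "k < N" for k
    using bij that by (auto simp: bij_betw_def)
  have inj: "root j = root k \<longleftrightarrow> j = k" if "j < N" "k < N" for j k
    using bij that by (auto simp: bij_betw_def inj_on_def)
  have root_nz: "root k \<noteq> 0" for k by (simp add: root_def)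
  define ev where "ev z = (\<Sum>e\<in>E. w e * z powi a e)" for z
  define C where "C = circulant N E a w"
  define F where "F = mat N N (\<lambda>(j, k). root k ^ j)"
  define F' where "F' = mat N N (\<lambda>(k, j). inverse (root k) ^ j)"
  define D where "D = mat N N (\<lambda>(j, k). if j = k then ev (root k) else 0)"
  have carrier: "C \<in> carrier_mat N N" "F \<in> carrier_mat N N" "F' \<in> carrier_mat N N" "D \<in> carrier_mat N N"
    by (simp_all add: C_def circulant_def F_def F'_def D_def)
  have shift: "(\<Sum>j = 0..<N. of_bool (m mod int N = int j) * z ^ j) = z powi m"
    if "z ^ N = 1" for z :: complex and m
  proof -
    have "(\<Sum>j = 0..<N. of_bool (m mod int N = int j) * z ^ j) =
        (\<Sum>j = 0..<N. if j = nat (m mod int N) then z ^ j else 0)"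
      using \<open>N > 0\<close> by (intro sum.cong) auto
    also have "\<dots> = z ^ nat (m mod int N)"
      using \<open>N > 0\<close> by (simp add: nat_less_iff)
    also have "\<dots> = z powi (m mod int N)" using \<open>N > 0\<close> by (simp add: power_int_def)
    finally show ?thesis using power_int_mod_unity_root[OF that \<open>N > 0\<close>] by simp
  qed
  have "C * F = F * D"
  proof (rule eq_matI)
    fix i k assume "i < dim_row (F * D)" "k < dim_col (F * D)"
    then have ik: "i < N" "k < N" using carrier by auto
    have "(C * F) $$ (i, k) =
        (\<Sum>j = 0..<N. (\<Sum>e\<in>E. w e * of_bool ((int i + a e) mod int N = int j)) * root k ^ j)"
      using ik by (simp add: C_def circulant_def F_def scalar_prod_def)
    also have "\<dots> = (\<Sum>e\<in>E. w e * (\<Sum>j = 0..<N. of_bool ((int i + a e) mod int N = int j) * root k ^ j))"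
      unfolding sum_distrib_right sum_distrib_left mult.assoc by (rule sum.swap)
    also have "\<dots> = (\<Sum>e\<in>E. w e * (root k ^ i * root k powi a e))"
      using shift[OF root[OF ik(2)]] root_nz[of k] by (simp add: power_int_add)
    also have "\<dots> = root k ^ i * ev (root k)"
      by (simp add: ev_def sum_distrib_left mult.left_commute)
    also have "\<dots> = (F * D) $$ (i, k)"
      using ik by (simp add: F_def D_def scalar_prod_def if_distrib[of "\<lambda>x. _ * x"] cong: if_cong)
    finally show "(C * F) $$ (i, k) = (F * D) $$ (i, k)" .
  qed (use carrier in auto)
  then have "det C * det F = det F * det D"
    using carrier by (metis det_mult)
  moreover have "det F \<noteq> 0"
  proof -
    have "F' * F = of_nat N \<cdot>\<^sub>m 1\<^sub>m N"
    proof (rule eq_matI)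
      fix k l assume "k < dim_row (of_nat N \<cdot>\<^sub>m 1\<^sub>m N :: complex mat)" "l < dim_col (of_nat N \<cdot>\<^sub>m 1\<^sub>m N :: complex mat)"
      then have kl: "k < N" "l < N" by auto
      define z where "z = inverse (root k) * root l"
      have "(F' * F) $$ (k, l) = (\<Sum>j<N. z ^ j)"
        using kl by (simp add: F_def F'_def scalar_prod_def z_def power_mult_distrib atLeast0LessThan)
      also have "\<dots> = (if k = l then of_nat N else 0)"
      proof (cases "k = l")
        case True
        then show ?thesis using root_nz by (simp add: z_def)
      next
        case False
        then have "z \<noteq> 1" using inj[OF kl] root_nz[of k] by (auto simp: z_def field_simps)
        moreover have "z ^ N = 1"
          using root[OF kl(1)] root[OF kl(2)] by (simp add: z_def power_mult_distrib power_inverse)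
        ultimately show ?thesis using False by (simp add: geometric_sum)
      qed
      finally show "(F' * F) $$ (k, l) = (of_nat N \<cdot>\<^sub>m 1\<^sub>m N) $$ (k, l)" using kl by simp
    qed (use carrier in auto)
    then have "det F' * det F = of_nat N ^ N"
      using carrier by (metis det_mult det_smult det_one index_one_mat(3) mult.right_neutral)
    then show ?thesis using \<open>N > 0\<close> by auto
  qed
  ultimately have "det C = det D" by simp
  also have "\<dots> = prod_list (diag_mat D)"
    by (rule det_upper_triangular[of _ N]) (auto simp: D_def intro!: upper_triangularI)
  also have "\<dots> = (\<Prod>k = 0..<N. ev (root k))"
    by (simp add: prod_list_diag_prod D_def)
  also have "\<dots> = (\<Prod>z\<in>unity_roots N. ev z)"
    by (rule prod.reindex_bij_betw[OF bij])
  finally show ?thesis by (simp add: C_def ev_def)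
qed

lemma det_cong:
  fixes A B :: "nat \<Rightarrow> nat \<Rightarrow> int"
  assumes "\<And>i j. i < N \<Longrightarrow> j < N \<Longrightarrow> [A i j = B i j] (mod m)"
  shows "[det (mat N N (\<lambda>(i, j). A i j)) = det (mat N N (\<lambda>(i, j). B i j))] (mod m)"
  unfolding det_mat_eq_sum_permutations
proof (intro cong_sum cong_mult cong_prod cong_refl)
  fix \<sigma> i assume "\<sigma> \<in> {\<sigma>. \<sigma> permutes {0..<N}}" "i \<in> {0..<N}"
  then show "[A i (\<sigma> i) = B i (\<sigma> i)] (mod m)"
    using permutes_in_image[of \<sigma> "{0..<N}" i] by (intro assms) auto
qed

abbreviation int_poly_at :: "int poly \<Rightarrow> complex \<Rightarrow> complex" where
  "int_poly_at P z \<equiv> poly (of_int_poly P) z"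

text \<open>
  The product is symmetric in the roots of unity, hence an integer; writing it as the determinant of an
  integral circulant matrix proves this and allows reduction modulo \<open>m\<close>.
\<close>

lemma unity_root_product_integer:
  assumes "N > 0"
  shows "(\<Prod>z\<in>unity_roots N. int_poly_at P z) =
           of_int (det (circulant N {..degree P} int (coeff P)))"
proof -
  let ?d = "det (circulant N {..degree P} int (coeff P))"
  have "of_int ?d = det (map_mat of_int (circulant N {..degree P} int (coeff P)) :: complex mat)"
    by simp
  also have "map_mat of_int (circulant N {..degree P} int (coeff P)) =
      (circulant N {..degree P} int (\<lambda>e. of_int (coeff P e)) :: complex mat)"
    by (rule eq_matI) (auto simp: circulant_def)
  also have "det \<dots> = (\<Prod>z\<in>unity_roots N. \<Sum>e\<le>degree P. of_int (coeff P e) * z powi int e)"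
    using assms by (rule det_circulant) simp
  also have "\<dots> = (\<Prod>z\<in>unity_roots N. int_poly_at P z)"
    by (simp add: poly_altdef)
  finally show "(\<Prod>z\<in>unity_roots N. int_poly_at P z) = of_int ?d" by simp
qed

lemma unity_root_product_mod:
  assumes "N > 0" and d: "(\<Prod>z\<in>unity_roots N. int_poly_at ([:c:] + Polynomial.smult m K) z) = of_int d"
  shows "[d = c ^ N] (mod m)"
proof -
  let ?P = "[:c:] + Polynomial.smult m K"
  have "d = det (circulant N {..degree ?P} int (coeff ?P))"
    using d unfolding unity_root_product_integer[OF \<open>N > 0\<close>] of_int_eq_iff by (rule sym)
  also have "[\<dots> = det (mat N N (\<lambda>(i, j). c * of_bool (i = j)))] (mod m)"
    unfolding circulant_def
  proof (rule det_cong)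
    fix i j assume ij: "i < N" "j < N"
    have "[(\<Sum>e\<le>degree ?P. coeff ?P e * of_bool ((int i + int e) mod int N = int j)) =
        (\<Sum>e\<le>degree ?P. if e = 0 then c * of_bool (i = j) else 0)] (mod m)"
    proof (rule cong_sum)
      fix e
      have "[coeff ?P e = (if e = 0 then c else 0)] (mod m)"
        by (auto simp: cong_def coeff_pCons split: nat.splits)
      moreover have "(int i mod int N = int j) = (i = j)" using ij by simp
      ultimately show "[coeff ?P e * of_bool ((int i + int e) mod int N = int j) =
          (if e = 0 then c * of_bool (i = j) else 0)] (mod m)"
        using cong_scalar_right[of "coeff ?P e" "if e = 0 then c else 0" m "of_bool ((int i + int e) mod int N = int j)"]
        by (cases "e = 0") simp_all
    qed
    then show "[(\<Sum>e\<le>degree ?P. coeff ?P e * of_bool ((int i + int e) mod int N = int j)) =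
        c * of_bool (i = j)] (mod m)"
      by simp
  qed
  also have "det (mat N N (\<lambda>(i, j). c * of_bool (i = j))) = c ^ N"
  proof -
    have "mat N N (\<lambda>(i, j). c * of_bool (i = j)) = c \<cdot>\<^sub>m 1\<^sub>m N" by (rule eq_matI) auto
    then show ?thesis by simp
  qed
  finally show ?thesis .
qed

section \<open>Products over roots of unity of prime power order\<close>

text \<open>
  The Frobenius map is additive modulo \<open>p\<close>, in a form that applies to integral polynomials.
\<close>

lemma prime_dvd_power_add_diff:
  fixes a b :: "'a :: comm_ring_1"
  assumes p: "prime p"
  shows "of_nat p dvd (a + b) ^ (p ^ n) - (a ^ (p ^ n) + b ^ (p ^ n))"
proof (induction n)
  case (Suc n)
  have prime_case: "of_nat p dvd (x + y) ^ p - (x ^ p + y ^ p)" for x y :: 'a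
  proof -
    have "p > 0" using p prime_gt_0_nat by blast
    have "{..p} = insert 0 (insert p {0<..<p})" using \<open>p > 0\<close> by auto
    then have "(x + y) ^ p - (x ^ p + y ^ p) = (\<Sum>k\<in>{0<..<p}. of_nat (p choose k) * x ^ k * y ^ (p - k))"
      using \<open>p > 0\<close> unfolding binomial_ring by simp
    moreover have "of_nat p dvd (of_nat (p choose k) :: 'a)" if "k \<in> {0<..<p}" for k
    proof -
      have "p dvd p choose k" using that p by (intro dvd_choose_prime) auto
      then show ?thesis by (elim dvdE) simp
    qed
    ultimately show ?thesis by (auto intro!: dvd_sum dvd_mult2)
  qed
  let ?s = "(a + b) ^ (p ^ n)" and ?a = "a ^ (p ^ n)" and ?b = "b ^ (p ^ n)"
  have "?s - (?a + ?b) dvd ?s ^ p - (?a + ?b) ^ p"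
    by (metis dvd_triv_left power_diff_sumr2)
  then have "of_nat p dvd ?s ^ p - (?a + ?b) ^ p" using Suc.IH dvd_trans by blast
  then have "of_nat p dvd (?s ^ p - (?a + ?b) ^ p) + ((?a + ?b) ^ p - (?a ^ p + ?b ^ p))"
    using prime_case by (rule dvd_add)
  then have "of_nat p dvd ?s ^ p - (?a ^ p + ?b ^ p)" by (simp only: diff_add_cancel add_diff_eq)
  then show ?case by (simp only: power_mult[symmetric] power_Suc2)
qed simp

lemma int_poly_at_simps:
  "int_poly_at (P + Q) z = int_poly_at P z + int_poly_at Q z"
  "int_poly_at (P - Q) z = int_poly_at P z - int_poly_at Q z"
  "int_poly_at (P * Q) z = int_poly_at P z * int_poly_at Q z"
  "int_poly_at (P ^ m) z = int_poly_at P z ^ m"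
  "int_poly_at (Polynomial.smult c P) z = of_int c * int_poly_at P z"
  "int_poly_at (of_nat m) z = of_nat m"
  "int_poly_at (of_int c) z = of_int c"
  "int_poly_at 1 z = 1"
  "int_poly_at [:c:] z = of_int c"
  "int_poly_at [:c, d:] z = of_int c + of_int d * z"
  "int_poly_at (monom c m) z = of_int c * z ^ m"
  "int_poly_at (sum R A) z = (\<Sum>x\<in>A. int_poly_at (R x) z)"
  "int_poly_at (prod R A) z = (\<Prod>x\<in>A. int_poly_at (R x) z)"
  by (simp_all add: hom_distribs poly_monom poly_sum poly_prod of_nat_poly of_int_poly)

text \<open>
  Modulo \<open>p\<close> there is only one \<open>p ^ n\<close>-th root of unity, so the product should be congruent to a power of
  \<open>poly P 1\<close>. To see this without leaving \<open>\<int>[z]\<close>, write \<open>P = c + (x - 1) * W\<close>. The Frobenius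
  congruence shows that \<open>P(z) ^ (p ^ n)\<close> is \<open>c ^ (p ^ n)\<close> plus \<open>p\<close> times an integral polynomial in \<open>z\<close>, and for
  such values the product is known modulo \<open>p\<close>.
\<close>

lemma unity_root_product_not_dvd:
  assumes p: "prime p" and c: "\<not> int p dvd poly P 1"
    and d: "(\<Prod>z\<in>unity_roots (p ^ n). int_poly_at P z) = of_int d"
  shows "\<not> int p dvd d"
proof -
  define N c where "N = p ^ n" and "c = poly P 1"
  have "N > 0" using p by (simp add: N_def prime_gt_0_nat)
  have "[:-1, 1:] dvd P - [:c:]" by (simp add: c_def dvd_iff_poly_eq_0)
  then obtain W where W: "P - [:c:] = [:-1, 1:] * W" by (elim dvdE)
  obtain K1 where K1: "([:c:] + [:-1, 1:] * W) ^ N - ([:c:] ^ N + ([:-1, 1:] * W) ^ N) = of_nat p * K1"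
    using prime_dvd_power_add_diff[OF p, of "[:c:]" "[:-1, 1:] * W" n] unfolding N_def by (elim dvdE)
  obtain K2 where K2: "([:-1, 1:] + 1) ^ N - ([:-1, 1:] ^ N + 1 ^ N) = of_nat p * (K2 :: int poly)"
    using prime_dvd_power_add_diff[OF p, of "[:-1, 1:] :: int poly" 1 n] unfolding N_def by (elim dvdE)
  define K where "K = K1 - K2 * W ^ N"
  have "int_poly_at P z ^ N = int_poly_at ([:c ^ N:] + Polynomial.smult (int p) K) z" if z: "z ^ N = 1" for z
  proof -
    have P: "P = [:c:] + [:-1, 1:] * W" using W by (simp add: algebra_simps)
    have 1: "(of_int c + (z - 1) * int_poly_at W z) ^ N -
        (of_int c ^ N + (z - 1) ^ N * int_poly_at W z ^ N) = of_nat p * int_poly_at K1 z"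
      using arg_cong[OF K1, of "\<lambda>Q. int_poly_at Q z"]
      by (simp add: int_poly_at_simps power_mult_distrib del: mult_pCons_left mult_pCons_right)
    have 2: "z ^ N - ((z - 1) ^ N + 1) = of_nat p * int_poly_at K2 z"
      using arg_cong[OF K2, of "\<lambda>Q. int_poly_at Q z"] by (simp add: int_poly_at_simps)
    have 3: "(z - 1) ^ N = - (of_nat p * int_poly_at K2 z)" by (simp add: z flip: 2)
    have "int_poly_at P z ^ N = (of_int c + (z - 1) * int_poly_at W z) ^ N"
      unfolding P by (simp add: int_poly_at_simps del: mult_pCons_left mult_pCons_right)
    also have "\<dots> = of_int c ^ N + (z - 1) ^ N * int_poly_at W z ^ N + of_nat p * int_poly_at K1 z"
      using 1 by (simp add: algebra_simps)
    also have "\<dots> = int_poly_at ([:c ^ N:] + Polynomial.smult (int p) K) z"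
      unfolding 3 by (simp add: K_def int_poly_at_simps algebra_simps)
    finally show ?thesis .
  qed
  then have "(\<Prod>z\<in>unity_roots N. int_poly_at ([:c ^ N:] + Polynomial.smult (int p) K) z) =
      (\<Prod>z\<in>unity_roots N. int_poly_at P z ^ N)"
    by (intro prod.cong) auto
  also have "\<dots> = of_int (d ^ N)"
    using d by (simp add: prod_power_distrib[symmetric] N_def)
  finally have "[d ^ N = (c ^ N) ^ N] (mod int p)"
    by (rule unity_root_product_mod[OF \<open>N > 0\<close>])
  moreover have "\<not> int p dvd (c ^ N) ^ N"
    using c p by (metis c_def prime_dvd_power prime_int_nat_transfer prime_nat_int_transfer)
  ultimately have "\<not> int p dvd d ^ N" by (simp add: cong_dvd_iff)
  then show ?thesis using \<open>N > 0\<close> dvd_power_iff dvd_trans by (metis dvd_power)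
qed

lemma prod_one_minus_unity_roots:
  assumes "N > 0"
  shows "(\<Prod>z\<in>unity_roots N - {1}. 1 - z) = of_nat N"
proof -
  define P :: "complex poly" where "P = monom 1 N - 1"
  have roots: "poly P z = 0 \<longleftrightarrow> z \<in> unity_roots N" for z
    by (simp add: P_def poly_monom)
  have deg: "degree P = N"
    unfolding P_def using assms degree_add_eq_left[of "-1 :: complex poly" "monom 1 N"]
    by (simp add: degree_monom_eq)
  then have lead: "lead_coeff P = 1" using assms by (simp add: P_def)
  have "pderiv P = monom (of_nat N) (N - 1)" by (simp add: P_def pderiv_diff pderiv_monom)
  then have "rsquarefree P"
    using assms unfolding rsquarefree_roots roots by (auto simp: poly_monom power_0_left split: if_splits)
  then have "P = (\<Prod>z | poly P z = 0. [:-z, 1:])"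
    using complex_poly_decompose_rsquarefree[of P] lead by simp
  also have "\<dots> = (\<Prod>z\<in>insert 1 (unity_roots N - {1}). [:-z, 1:])"
    by (intro prod.cong) (auto simp: roots)
  also have "\<dots> = [:-1, 1:] * (\<Prod>z\<in>unity_roots N - {1}. [:-z, 1:])"
    using finite_roots_unity[of N, where 'a = complex] assms by (subst prod.insert) auto
  finally have 1: "P = [:-1, 1:] * (\<Prod>z\<in>unity_roots N - {1}. [:-z, 1:])" .
  have 2: "P = [:-1, 1:] * (\<Sum>i<N. monom 1 i)"
  proof -
    have "[:-1, 1:] = [:0, 1:] - (1 :: complex poly)" by (simp add: one_pCons)
    then show ?thesis unfolding P_def monom_altdef smult_1_left by (simp only: power_diff_1_eq)
  qed
  have "(\<Prod>z\<in>unity_roots N - {1}. [:-z, 1:]) = (\<Sum>i<N. monom (1 :: complex) i)"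
    using 1 2 by (metis mult_cancel_left one_neq_zero pCons_eq_0_iff)
  then have "poly (\<Prod>z\<in>unity_roots N - {1}. [:-z, 1:]) 1 = poly (\<Sum>i<N. monom (1 :: complex) i) 1"
    by simp
  then show ?thesis by (simp add: poly_prod poly_sum poly_monom)
qed

lemma unity_roots_prime_power_Suc:
  "unity_roots (p ^ n) \<subseteq> unity_roots (p ^ Suc n)"
  unfolding power_Suc2 power_mult by auto

lemma prod_unity_roots_Suc:
  fixes h :: "complex \<Rightarrow> complex"
  assumes "prime p"
  shows "(\<Prod>z\<in>unity_roots (p ^ Suc n). h z) =
    (\<Prod>z\<in>unity_roots (p ^ Suc n) - unity_roots (p ^ n). h z) * (\<Prod>z\<in>unity_roots (p ^ n). h z)"
  using assms unity_roots_prime_power_Suc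
  by (intro prod.subset_diff finite_roots_unity) (auto simp: Suc_le_eq prime_gt_0_nat)

text \<open>
  A power of \<open>z\<close> that is \<open>1\<close> may be replaced by the gcd of its exponent with \<open>p ^ Suc n\<close>, which is a
  power of \<open>p\<close>; no smaller one than \<open>p ^ Suc n\<close> itself is possible.
\<close>

lemma unity_root_order:
  assumes p: "prime p" and z: "z \<in> unity_roots (p ^ Suc n) - unity_roots (p ^ n)"
  shows "z ^ m = 1 \<longleftrightarrow> p ^ Suc n dvd m"
proof
  assume m: "z ^ m = 1"
  show "p ^ Suc n dvd m"
  proof (cases "m = 0")
    case False
    obtain x y where xy: "m * x = p ^ Suc n * y + gcd m (p ^ Suc n)"
      using bezout_nat[OF False] by blast
    have "z ^ (m * x) = 1" "z ^ (p ^ Suc n * y) = 1"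
      using m z by (simp_all add: power_mult del: power_Suc)
    then have g: "z ^ gcd m (p ^ Suc n) = 1" unfolding xy by (simp add: power_add)
    obtain t where t: "t \<le> Suc n" "gcd m (p ^ Suc n) = p ^ t"
      using iffD1[OF divides_primepow_nat[OF p] gcd_dvd2] by blast
    have "\<not> t \<le> n"
    proof
      assume "t \<le> n"
      then have "p ^ n = p ^ t * p ^ (n - t)" by (simp flip: power_add)
      then have "z ^ (p ^ n) = 1" using g t(2) by (simp add: power_mult)
      then show False using z by simp
    qed
    then have "t = Suc n" using t(1) by simp
    then show ?thesis using gcd_dvd1[of m "p ^ Suc n"] unfolding t(2) by (simp only:)
  qed simp
next
  assume "p ^ Suc n dvd m"
  then obtain y where "m = p ^ Suc n * y" by (rule dvdE)
  then show "z ^ m = 1" using z by (simp add: power_mult del: power_Suc)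
qed

lemma primitive_roots_eq_powers:
  assumes p: "prime p" and z: "z \<in> unity_roots (p ^ Suc n) - unity_roots (p ^ n)"
  shows "bij_betw (\<lambda>i. z ^ i) {i. i < p ^ Suc n \<and> \<not> p dvd i}
           (unity_roots (p ^ Suc n) - unity_roots (p ^ n))"
proof -
  let ?N = "p ^ Suc n"
  have "?N > 0" using p prime_gt_0_nat by simp
  have nz: "z \<noteq> 0" using z \<open>?N > 0\<close> by (auto simp: power_0_left simp del: power_Suc)
  have inj: "inj_on (\<lambda>i. z ^ i) {..<?N}"
  proof (rule linorder_inj_onI)
    fix i j :: nat assume ij: "i < j" "i \<in> {..<?N}" "j \<in> {..<?N}"
    show "z ^ i \<noteq> z ^ j"
    proof
      assume "z ^ i = z ^ j"
      then have "z ^ (j - i) = 1" using ij nz by (simp add: power_diff)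
      then have "?N dvd j - i" using unity_root_order[OF p z] by simp
      then show False using ij by (auto dest: dvd_imp_le simp del: power_Suc)
    qed
  qed auto
  have sub: "(\<lambda>i. z ^ i) ` {..<?N} \<subseteq> unity_roots ?N"
  proof clarify
    fix i
    have "(z ^ i) ^ ?N = (z ^ ?N) ^ i" by (simp only: power_mult[symmetric] mult.commute)
    also have "z ^ ?N = 1" using z by simp
    finally show "(z ^ i) ^ ?N = 1" by simp
  qed
  have image: "(\<lambda>i. z ^ i) ` {..<?N} = unity_roots ?N"
  proof (rule card_subset_eq[OF _ sub])
    show "finite (unity_roots ?N)" using \<open>?N > 0\<close> by (intro finite_roots_unity) linarith
    show "card ((\<lambda>i. z ^ i) ` {..<?N}) = card (unity_roots ?N)"
      using card_image[OF inj] card_roots_unity_eq[OF \<open>?N > 0\<close>] by simp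
  qed
  have "z ^ i \<in> unity_roots (p ^ n) \<longleftrightarrow> p dvd i" for i
  proof -
    have "(z ^ i) ^ (p ^ n) = z ^ (p ^ n * i)" by (simp add: power_mult[symmetric] mult.commute)
    then have "z ^ i \<in> unity_roots (p ^ n) \<longleftrightarrow> p ^ Suc n dvd p ^ n * i"
      unfolding unity_root_order[OF p z, symmetric] by simp
    also have "\<dots> \<longleftrightarrow> p dvd i" using p by (simp add: power_Suc2 prime_gt_0_nat del: power_Suc)
    finally show ?thesis .
  qed
  then have "(\<lambda>i. z ^ i) ` {i. i < ?N \<and> \<not> p dvd i} = unity_roots ?N - unity_roots (p ^ n)"
    unfolding image[symmetric] by auto
  moreover have "inj_on (\<lambda>i. z ^ i) {i. i < ?N \<and> \<not> p dvd i}"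
    using inj by (rule inj_on_subset) auto
  ultimately show ?thesis by (simp add: bij_betw_def)
qed

lemma prod_one_minus_primitive_roots:
  assumes p: "prime p"
  shows "(\<Prod>z\<in>unity_roots (p ^ Suc n) - unity_roots (p ^ n). 1 - z) = of_nat p"
proof -
  have pos: "p ^ n > 0" "p ^ Suc n > 0" using p prime_gt_0_nat by auto
  have fin: "finite (unity_roots (p ^ Suc n) - {1})"
    using pos(2) by (intro finite_Diff finite_roots_unity) simp
  have "of_nat (p ^ Suc n) = (\<Prod>z\<in>unity_roots (p ^ Suc n) - {1}. 1 - z)"
    by (rule prod_one_minus_unity_roots[OF pos(2), symmetric])
  also have "\<dots> = (\<Prod>z\<in>unity_roots (p ^ Suc n) - {1} - (unity_roots (p ^ n) - {1}). 1 - z) *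
      (\<Prod>z\<in>unity_roots (p ^ n) - {1}. 1 - z)"
    using unity_roots_prime_power_Suc fin by (intro prod.subset_diff) auto
  also have "(\<Prod>z\<in>unity_roots (p ^ n) - {1}. 1 - z) = of_nat (p ^ n)"
    by (rule prod_one_minus_unity_roots[OF pos(1)])
  also have "unity_roots (p ^ Suc n) - {1} - (unity_roots (p ^ n) - {1}) =
      unity_roots (p ^ Suc n) - unity_roots (p ^ n)"
    by auto
  finally show ?thesis using pos by simp
qed

lemma card_primitive_roots:
  assumes p: "prime p"
  shows "card (unity_roots (p ^ Suc n) - unity_roots (p ^ n)) = p ^ Suc n - p ^ n"
proof -
  have pos: "p ^ n > 0" "p ^ Suc n > 0" using p prime_gt_0_nat by auto
  then show ?thesis
    using unity_roots_prime_power_Suc card_roots_unity_eq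
    by (subst card_Diff_subset) (auto intro!: finite_roots_unity simp: Suc_le_eq card_roots_unity_eq simp del: power_Suc)
qed

text \<open>
  The product of all \<open>1 - z ^ i\<close>, with \<open>i\<close> prime to \<open>p\<close>, is \<open>p\<close>, and every factor is divisible by \<open>1 - z\<close>. It matters that
  the cofactor is the same polynomial \<open>U\<close> for all primitive \<open>z\<close>.
\<close>

lemma prime_eq_power_one_minus_primitive_root:
  assumes p: "prime p"
  shows "\<exists>U. \<forall>z \<in> unity_roots (p ^ Suc n) - unity_roots (p ^ n).
           of_nat p = (1 - z) ^ (p ^ Suc n - p ^ n) * int_poly_at U z"
proof (intro exI ballI)
  let ?I = "{i. i < p ^ Suc n \<and> \<not> p dvd i}"
  fix z assume z: "z \<in> unity_roots (p ^ Suc n) - unity_roots (p ^ n)"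
  note bij = primitive_roots_eq_powers[OF p z]
  have "of_nat p = (\<Prod>z\<in>unity_roots (p ^ Suc n) - unity_roots (p ^ n). 1 - z)"
    by (rule prod_one_minus_primitive_roots[OF p, symmetric])
  also have "\<dots> = (\<Prod>i\<in>?I. 1 - z ^ i)"
    by (rule prod.reindex_bij_betw[OF bij, symmetric])
  also have "\<dots> = (\<Prod>i\<in>?I. (1 - z) * (\<Sum>j<i. z ^ j))"
    by (simp only: one_diff_power_eq)
  also have "\<dots> = (1 - z) ^ card ?I * (\<Prod>i\<in>?I. \<Sum>j<i. z ^ j)"
    by (simp add: prod.distrib)
  also have "card ?I = p ^ Suc n - p ^ n"
    using bij_betw_same_card[OF bij] card_primitive_roots[OF p] by simp
  also have "(\<Prod>i\<in>?I. \<Sum>j<i. z ^ j) = int_poly_at (\<Prod>i\<in>?I. \<Sum>j<i. monom 1 j) z"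
    by (simp only: int_poly_at_simps) simp
  finally show "of_nat p = (1 - z) ^ (p ^ Suc n - p ^ n) *
      int_poly_at (\<Prod>i\<in>?I. \<Sum>j<i. monom 1 j) z" .
qed

text \<open>
  The statement says that the product has \<open>p\<close>-adic valuation \<open>r\<close>. Dividing by \<open>(1 - z) ^ r\<close> leaves a
  polynomial \<open>Q\<close> with \<open>Q(1) = c\<close>, since \<open>p\<close> is divisible by a higher power of \<open>1 - z\<close>. The product of the
  values of \<open>Q\<close> at the primitive roots is the quotient \<open>a / b\<close> of its products over all roots of unity in
  two consecutive layers, both integers prime to \<open>p\<close>; so the quotient need not be shown to be an integer.
\<close>

theorem primitive_root_product_valuation:
  assumes p: "prime p" and c: "\<not> int p dvd c" and r: "r < p ^ Suc n - p ^ n"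
  shows "\<exists>a b. \<not> int p dvd a \<and> \<not> int p dvd b \<and>
    (\<Prod>z\<in>unity_roots (p ^ Suc n) - unity_roots (p ^ n).
        of_int c * (1 - z) ^ r + of_nat p * int_poly_at H z) * of_int b = of_nat p ^ r * of_int a"
proof -
  let ?prim = "unity_roots (p ^ Suc n) - unity_roots (p ^ n)"
  have pos: "p ^ n > 0" "p ^ Suc n > 0" using p prime_gt_0_nat by auto
  from prime_eq_power_one_minus_primitive_root[OF p] obtain U :: "int poly"
    where U: "\<forall>z\<in>?prim. of_nat p = (1 - z) ^ (p ^ Suc n - p ^ n) * int_poly_at U z" ..
  define Q where "Q = [:c:] + [:1, -1:] ^ (p ^ Suc n - p ^ n - r) * U * H"
  have "p ^ Suc n - p ^ n - r > 0" using r by linarith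
  then have "poly Q 1 = c" by (simp add: Q_def power_0_left del: power_Suc)
  then have Q: "\<not> int p dvd poly Q 1" using c by simp
  obtain a where a: "(\<Prod>z\<in>unity_roots (p ^ Suc n). int_poly_at Q z) = of_int a"
    using unity_root_product_integer[OF pos(2)] by blast
  obtain b where b: "(\<Prod>z\<in>unity_roots (p ^ n). int_poly_at Q z) = of_int b"
    using unity_root_product_integer[OF pos(1)] by blast
  have factor: "of_int c * (1 - z) ^ r + of_nat p * int_poly_at H z = (1 - z) ^ r * int_poly_at Q z"
    if "z \<in> ?prim" for z
  proof -
    have "(1 - z) ^ (p ^ Suc n - p ^ n) = (1 - z) ^ (r + (p ^ Suc n - p ^ n - r))"
      using r by (metis le_add_diff_inverse less_imp_le)
    then have "of_nat p = (1 - z) ^ r * ((1 - z) ^ (p ^ Suc n - p ^ n - r) * int_poly_at U z)"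
      using bspec[OF U that] by (simp only: power_add mult.assoc)
    moreover have "int_poly_at Q z =
        of_int c + (1 - z) ^ (p ^ Suc n - p ^ n - r) * int_poly_at U z * int_poly_at H z"
      by (simp add: Q_def int_poly_at_simps)
    ultimately show ?thesis by (simp only: distrib_left mult.assoc mult.commute[of "of_int c"])
  qed
  have "(\<Prod>z\<in>?prim. of_int c * (1 - z) ^ r + of_nat p * int_poly_at H z) * of_int b =
      (\<Prod>z\<in>?prim. (1 - z) ^ r) * ((\<Prod>z\<in>?prim. int_poly_at Q z) * (\<Prod>z\<in>unity_roots (p ^ n). int_poly_at Q z))"
    unfolding b[symmetric] mult.assoc[symmetric] prod.distrib[symmetric]
    by (intro arg_cong2[of _ _ _ _ "(*)"] prod.cong refl factor)
  also have "(\<Prod>z\<in>?prim. int_poly_at Q z) * (\<Prod>z\<in>unity_roots (p ^ n). int_poly_at Q z) = of_int a"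
    unfolding a[symmetric] by (rule prod_unity_roots_Suc[OF p, symmetric])
  also have "(\<Prod>z\<in>?prim. (1 - z) ^ r) = of_nat p ^ r"
    unfolding prod_power_distrib[symmetric] prod_one_minus_primitive_roots[OF p] ..
  finally show ?thesis
    using unity_root_product_not_dvd[OF p Q a] unity_root_product_not_dvd[OF p Q b]
    by (intro exI[of _ a] exI[of _ b] conjI)
qed

section \<open>The finite layers of the group of $p$-adic integers\<close>

lemma mem_padic_int_group:
  assumes "p > 0"
  shows "x \<in> carrier (padic_int_group p) \<longleftrightarrow>
    (\<forall>n. 0 \<le> x n \<and> x n < int p ^ n) \<and> (\<forall>m n. m \<le> n \<longrightarrow> x n mod int p ^ m = x m)"
  using assms by (auto simp: padic_int_group_def Let_def carrier_integer_mod_group PiE_UNIV_domain Pi_iff)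

lemma padic_int_group_mult:
  "(x \<otimes>\<^bsub>padic_int_group p\<^esub> y) n = (x n + y n) mod int p ^ n"
  by (simp add: padic_int_group_def Let_def mult_integer_mod_group)

lemma padic_int_group_one: "\<one>\<^bsub>padic_int_group p\<^esub> n = 0"
  by (simp add: padic_int_group_def Let_def)

lemma comm_group_padic_int_group:
  assumes "p > 0"
  shows "comm_group (padic_int_group p)"
  using group_padic_int_group[OF assms]
  by (rule group.group_comm_groupI) (simp add: fun_eq_iff padic_int_group_mult add.commute)

definition padic_of_int :: "nat \<Rightarrow> int \<Rightarrow> nat \<Rightarrow> int" where
  "padic_of_int p a = (\<lambda>n. a mod int p ^ n)"

lemma padic_of_int_closed:
  assumes "p > 0"
  shows "padic_of_int p a \<in> carrier (padic_int_group p)"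
  using assms unfolding mem_padic_int_group[OF assms] padic_of_int_def
  by (auto simp: mod_mod_cancel le_imp_power_dvd)

lemma padic_of_int_add:
  "padic_of_int p a \<otimes>\<^bsub>padic_int_group p\<^esub> padic_of_int p b = padic_of_int p (a + b)"
  by (simp add: fun_eq_iff padic_int_group_mult padic_of_int_def mod_add_eq)

lemma padic_of_int_minus:
  assumes "p > 0"
  shows "padic_of_int p (- a) = inv\<^bsub>padic_int_group p\<^esub> padic_of_int p a"
proof -
  interpret group "padic_int_group p" using assms by (rule group_padic_int_group)
  have "padic_of_int p (- a) \<otimes>\<^bsub>padic_int_group p\<^esub> padic_of_int p a = \<one>\<^bsub>padic_int_group p\<^esub>"
    unfolding padic_of_int_add by (simp add: fun_eq_iff padic_int_group_one padic_of_int_def)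
  then have "inv\<^bsub>padic_int_group p\<^esub> padic_of_int p a = padic_of_int p (- a)"
    by (rule inv_equality) (rule padic_of_int_closed[OF assms])+
  then show ?thesis by (rule sym)
qed

lemma padic_int_group_pow:
  assumes "p > 0"
  shows "(x [^]\<^bsub>padic_int_group p\<^esub> k) n = (int k * x n) mod int p ^ n"
proof (induction k)
  case 0
  then show ?case by (simp add: padic_int_group_one)
next
  case (Suc k)
  then show ?case by (simp add: padic_int_group_mult mod_simps algebra_simps)
qed

text \<open>
  A \<open>p\<close>-adic integer that vanishes modulo \<open>p ^ n\<close> is divided by \<open>p ^ n\<close> by shifting the sequence by \<open>n\<close>
  places and dividing its entries.
\<close>

lemma powers_padic_int_group:
  assumes "p > 0"
  shows "powers (padic_int_group p) (p ^ n) = {x \<in> carrier (padic_int_group p). x n = 0}"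
proof (intro equalityI subsetI)
  interpret group "padic_int_group p" using assms by (rule group_padic_int_group)
  fix x assume "x \<in> powers (padic_int_group p) (p ^ n)"
  then obtain y where y: "y \<in> carrier (padic_int_group p)" "x = y [^]\<^bsub>padic_int_group p\<^esub> (p ^ n)"
    by (auto simp: powers_def)
  then have "x \<in> carrier (padic_int_group p)" by simp
  moreover have "x n = 0" unfolding y(2) padic_int_group_pow[OF assms] by simp
  ultimately show "x \<in> {x \<in> carrier (padic_int_group p). x n = 0}" by simp
next
  fix x assume "x \<in> {x \<in> carrier (padic_int_group p). x n = 0}"
  then have x: "x n = 0" "\<And>k. 0 \<le> x k" "\<And>k. x k < int p ^ k" "\<And>j k. j \<le> k \<Longrightarrow> x k mod int p ^ j = x j"
    by (auto simp: mem_padic_int_group[OF assms])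
  have dvd: "int p ^ n dvd x (k + n)" for k using x(4)[of n "k + n"] x(1) by auto
  \<comment> \<open>The \<open>p ^ n\<close>-th root, that is, the quotient of \<open>x\<close> by \<open>p ^ n\<close>.\<close>
  define y where "y k = x (k + n) div int p ^ n" for k
  have xy: "x (k + n) = int p ^ n * y k" for k using dvd[of k] by (simp add: y_def)
  have pos: "int p ^ j > 0" for j using assms by simp
  have "y \<in> carrier (padic_int_group p)"
    unfolding mem_padic_int_group[OF assms]
  proof (intro conjI allI impI)
    fix k
    show "0 \<le> y k" unfolding y_def pos_imp_zdiv_nonneg_iff[OF pos] by (rule x(2))
    have "int p ^ n * y k < int p ^ n * int p ^ k"
      using x(3)[of "k + n"] unfolding xy power_add mult.commute[of "int p ^ k"] .
    then show "y k < int p ^ k" using pos[of n] by (rule mult_left_less_imp_less[OF _ less_imp_le])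
  next
    fix j k :: nat assume "j \<le> k"
    then have "x (k + n) mod int p ^ (j + n) = x (j + n)" using x(4) by simp
    moreover have "int p ^ (j + n) = int p ^ n * int p ^ j" by (simp add: power_add)
    ultimately have "int p ^ n * (y k mod int p ^ j) = int p ^ n * y j"
      unfolding mult_mod_right by (simp only: xy)
    then show "y k mod int p ^ j = y j" using assms by simp
  qed
  moreover have "x = y [^]\<^bsub>padic_int_group p\<^esub> (p ^ n)"
  proof
    fix k
    have "(y [^]\<^bsub>padic_int_group p\<^esub> (p ^ n)) k = x (k + n) mod int p ^ k"
      by (simp only: padic_int_group_pow[OF assms] xy of_nat_power)
    also have "\<dots> = x k" by (rule x(4)) simp
    finally show "x k = (y [^]\<^bsub>padic_int_group p\<^esub> (p ^ n)) k" by simp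
  qed
  ultimately show "x \<in> powers (padic_int_group p) (p ^ n)" unfolding powers_def by blast
qed

lemma normal_powers_padic_int_group:
  assumes "p > 0"
  shows "powers (padic_int_group p) (p ^ n) \<lhd> padic_int_group p"
proof -
  interpret comm_group "padic_int_group p" using assms by (rule comm_group_padic_int_group)
  have "subgroup (powers (padic_int_group p) (p ^ n)) (padic_int_group p)"
  proof (rule subgroupI)
    fix a b assume "a \<in> powers (padic_int_group p) (p ^ n)" "b \<in> powers (padic_int_group p) (p ^ n)"
    then show "inv\<^bsub>padic_int_group p\<^esub> a \<in> powers (padic_int_group p) (p ^ n)"
      "a \<otimes>\<^bsub>padic_int_group p\<^esub> b \<in> powers (padic_int_group p) (p ^ n)"
      unfolding powers_def
      by (auto simp: nat_pow_inv[symmetric] nat_pow_distrib[symmetric])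
  qed (auto simp: powers_def)
  then show ?thesis by (rule subgroup_imp_normal)
qed

lemma layer_proj_mult:
  assumes "p > 0" "x \<in> carrier (padic_int_group p)" "y \<in> carrier (padic_int_group p)"
  shows "layer_proj p (padic_int_group p) n x \<otimes>\<^bsub>layer_group p (padic_int_group p) n\<^esub>
      layer_proj p (padic_int_group p) n y =
    layer_proj p (padic_int_group p) n (x \<otimes>\<^bsub>padic_int_group p\<^esub> y)"
  using normal.r_coset_hom_Mod[OF normal_powers_padic_int_group[OF assms(1)], of n] assms(2,3)
  unfolding layer_group_def layer_proj_def hom_def by simp

text \<open>
  The \<open>p ^ n\<close>-th powers are the elements with vanishing \<open>n\<close>-th component, so this component identifies the
  quotient with \<open>\<int>/p\<^sup>n\<close>.
\<close>

lemma layer_proj_eq_iff: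
  assumes "p > 0" "x \<in> carrier (padic_int_group p)" "y \<in> carrier (padic_int_group p)"
  shows "layer_proj p (padic_int_group p) n x = layer_proj p (padic_int_group p) n y \<longleftrightarrow> x n = y n"
proof -
  interpret group "padic_int_group p" using assms(1) by (rule group_padic_int_group)
  let ?H = "powers (padic_int_group p) (p ^ n)"
  have H: "subgroup ?H (padic_int_group p)"
    using normal_powers_padic_int_group[OF assms(1)] by (rule normal_imp_subgroup)
  have bounds: "0 \<le> x n" "x n < int p ^ n" "0 \<le> y n" "y n < int p ^ n"
    using assms by (auto simp: mem_padic_int_group)
  define d where "d = x \<otimes>\<^bsub>padic_int_group p\<^esub> inv\<^bsub>padic_int_group p\<^esub> y"
  have d: "d \<in> carrier (padic_int_group p)" "x = d \<otimes>\<^bsub>padic_int_group p\<^esub> y"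
    using assms(2,3) by (simp_all add: d_def m_assoc)
  have "0 \<le> d n" "d n < int p ^ n" using d(1) mem_padic_int_group[OF assms(1)] by auto
  have "layer_proj p (padic_int_group p) n x = layer_proj p (padic_int_group p) n y \<longleftrightarrow> d \<in> ?H"
    unfolding layer_proj_def d_def subgroup.rcos_module[OF H is_group assms(3,2), symmetric]
    using rcos_self[OF assms(2) H] repr_independence[OF _ assms(3) H, of x] by auto
  also have "\<dots> \<longleftrightarrow> d n = 0" using d(1) by (simp add: powers_padic_int_group[OF assms(1)])
  also have "\<dots> \<longleftrightarrow> x n = y n"
  proof
    assume "d n = 0"
    then show "x n = y n" using bounds d(2) padic_int_group_mult[of p d y n] by simp
  next
    assume "x n = y n"
    then have "(d n + y n) mod int p ^ n = y n mod int p ^ n"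
      using bounds d(2) padic_int_group_mult[of p d y n] by simp
    then have "int p ^ n dvd d n" by (simp add: mod_eq_dvd_iff)
    then show "d n = 0" using \<open>0 \<le> d n\<close> \<open>d n < int p ^ n\<close> by (auto dest: zdvd_imp_le)
  qed
  finally show ?thesis .
qed

definition layer_element :: "nat \<Rightarrow> nat \<Rightarrow> int \<Rightarrow> (nat \<Rightarrow> int) set" where
  "layer_element p n a = layer_proj p (padic_int_group p) n (padic_of_int p a)"

lemma layer_element_eq_iff:
  assumes "p > 0"
  shows "layer_element p n a = layer_element p n b \<longleftrightarrow> a mod int p ^ n = b mod int p ^ n"
  unfolding layer_element_def layer_proj_eq_iff[OF assms padic_of_int_closed[OF assms] padic_of_int_closed[OF assms]]
  by (simp add: padic_of_int_def)

lemma layer_element_mult: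
  assumes "p > 0"
  shows "layer_element p n a \<otimes>\<^bsub>layer_group p (padic_int_group p) n\<^esub>
           layer_proj p (padic_int_group p) n (padic_of_int p b) = layer_element p n (a + b)"
  unfolding layer_element_def
    layer_proj_mult[OF assms padic_of_int_closed[OF assms] padic_of_int_closed[OF assms]]
    padic_of_int_add ..

lemma bij_betw_layer_element:
  assumes "p > 0"
  shows "bij_betw (\<lambda>i. layer_element p n (int i)) {0..<p ^ n}
           (carrier (layer_group p (padic_int_group p) n))"
  unfolding bij_betw_def
proof
  show "inj_on (\<lambda>i. layer_element p n (int i)) {0..<p ^ n}"
  proof (rule inj_onI)
    fix i j assume "i \<in> {0..<p ^ n}" "j \<in> {0..<p ^ n}"
      and "layer_element p n (int i) = layer_element p n (int j)"
    then have "int i < int p ^ n" "int j < int p ^ n" "int i mod int p ^ n = int j mod int p ^ n"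
      unfolding layer_element_eq_iff[OF assms] atLeastLessThan_iff of_nat_power[symmetric] of_nat_less_iff
      by blast+
    then show "i = j" by simp
  qed
  have carrier: "carrier (layer_group p (padic_int_group p) n) =
      layer_proj p (padic_int_group p) n ` carrier (padic_int_group p)"
    by (auto simp: layer_group_def FactGroup_def RCOSETS_def layer_proj_def)
  show "(\<lambda>i. layer_element p n (int i)) ` {0..<p ^ n} = carrier (layer_group p (padic_int_group p) n)"
    unfolding carrier
  proof (intro equalityI subsetI)
    fix c assume "c \<in> layer_proj p (padic_int_group p) n ` carrier (padic_int_group p)"
    then obtain x where x: "x \<in> carrier (padic_int_group p)" "c = layer_proj p (padic_int_group p) n x" by blast
    then have bounds: "0 \<le> x n" "x n < int p ^ n" using mem_padic_int_group[OF assms] by auto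
    then have "padic_of_int p (x n) n = x n" by (simp add: padic_of_int_def)
    then have "c = layer_element p n (x n)"
      unfolding x(2) layer_element_def
      using layer_proj_eq_iff[OF assms x(1) padic_of_int_closed[OF assms], of n "x n"] by simp
    then show "c \<in> (\<lambda>i. layer_element p n (int i)) ` {0..<p ^ n}"
      using bounds by (intro image_eqI[of _ _ "nat (x n)"]) (auto simp: nat_less_iff)
  qed (auto simp: layer_element_def padic_of_int_closed[OF assms])
qed

section \<open>Bouquets with integral voltages\<close>

text \<open>
  The loop of index \<open>j\<close> consists of the arcs \<open>2 * j\<close>, which carries the voltage \<open>as ! j\<close>, and \<open>2 * j + 1\<close>,
  which is its reverse.
\<close>

definition bouquet_graph :: "int list \<Rightarrow> (nat, nat) pre_digraph" where
  "bouquet_graph as = \<lparr>verts = {0}, arcs = {0..<2 * length as}, tail = (\<lambda>_. 0), head = (\<lambda>_. 0)\<rparr>"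

definition bouquet_arev :: "int list \<Rightarrow> nat \<Rightarrow> nat" where
  "bouquet_arev as e = (if e < 2 * length as then if even e then e + 1 else e - 1 else e)"

definition bouquet_voltage :: "int list \<Rightarrow> nat \<Rightarrow> int" where
  "bouquet_voltage as e = (if even e then as ! (e div 2) else - (as ! (e div 2)))"

lemma bouquet_graph_sel [simp]:
  "verts (bouquet_graph as) = {0}" "arcs (bouquet_graph as) = {0..<2 * length as}"
  "tail (bouquet_graph as) e = 0" "head (bouquet_graph as) e = 0"
  by (simp_all add: bouquet_graph_def)

lemma serre_graph_bouquet: "serre_graph (bouquet_graph as) (bouquet_arev as)"
proof -
  interpret fin_digraph "bouquet_graph as" by unfold_locales auto
  have "bidirected_digraph (bouquet_graph as) (bouquet_arev as)"
    by (rule bidirected_digraphI) (auto simp: bouquet_arev_def elim!: oddE evenE)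
  then interpret bidirected_digraph "bouquet_graph as" "bouquet_arev as" .
  show ?thesis by unfold_locales
qed

lemma voltage_assignment_bouquet:
  assumes "p > 0"
  shows "voltage_assignment (padic_int_group p) (bouquet_graph as) (bouquet_arev as)
           (\<lambda>e. padic_of_int p (bouquet_voltage as e))"
  unfolding voltage_assignment_def
proof
  fix e assume e: "e \<in> arcs (bouquet_graph as)"
  have "bouquet_voltage as (bouquet_arev as e) = - bouquet_voltage as e"
    using e by (auto simp: bouquet_voltage_def bouquet_arev_def elim!: oddE evenE)
  then show "padic_of_int p (bouquet_voltage as e) \<in> carrier (padic_int_group p) \<and>
      padic_of_int p (bouquet_voltage as (bouquet_arev as e)) =
      inv\<^bsub>padic_int_group p\<^esub> padic_of_int p (bouquet_voltage as e)"
    using padic_of_int_closed[OF assms] padic_of_int_minus[OF assms] by simp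
qed

abbreviation bouquet_layer :: "nat \<Rightarrow> int list \<Rightarrow> nat \<Rightarrow> ((nat \<Rightarrow> int) set \<times> nat, (nat \<Rightarrow> int) set \<times> nat) pre_digraph" where
  "bouquet_layer p as n \<equiv>
     derived_graph p (padic_int_group p) (bouquet_graph as) (\<lambda>e. padic_of_int p (bouquet_voltage as e)) n"

abbreviation bouquet_layer_arev :: "nat \<Rightarrow> int list \<Rightarrow> nat \<Rightarrow> (nat \<Rightarrow> int) set \<times> nat \<Rightarrow> (nat \<Rightarrow> int) set \<times> nat" where
  "bouquet_layer_arev p as n \<equiv>
     derived_arev p (padic_int_group p) (bouquet_graph as) (bouquet_arev as)
       (\<lambda>e. padic_of_int p (bouquet_voltage as e)) n"

definition layer_vertex :: "nat \<Rightarrow> nat \<Rightarrow> int \<Rightarrow> (nat \<Rightarrow> int) set \<times> nat" where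
  "layer_vertex p n a = (layer_element p n a, 0)"

lemma bij_betw_layer_vertex:
  assumes "p > 0"
  shows "bij_betw (\<lambda>i. layer_vertex p n (int i)) {0..<p ^ n} (verts (bouquet_layer p as n))"
proof -
  have verts: "verts (bouquet_layer p as n) = (\<lambda>c. (c, 0)) ` carrier (layer_group p (padic_int_group p) n)"
    by (auto simp: derived_graph_def)
  have "bij_betw (\<lambda>c. (c, 0 :: nat)) (carrier (layer_group p (padic_int_group p) n))
      (verts (bouquet_layer p as n))"
    unfolding verts by (intro inj_on_imp_bij_betw inj_onI) simp
  from bij_betw_trans[OF bij_betw_layer_element[OF assms] this] show ?thesis
    unfolding layer_vertex_def comp_def .
qed

lemma layer_vertex_eq_iff:
  assumes "p > 0"
  shows "layer_vertex p n a = layer_vertex p n b \<longleftrightarrow> a mod int (p ^ n) = b mod int (p ^ n)"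
  by (simp add: layer_vertex_def layer_element_eq_iff[OF assms])

lemma bouquet_layer_out_arcs:
  assumes "p > 0"
  shows "out_arcs (bouquet_layer p as n) (layer_vertex p n a) =
           (\<lambda>e. (layer_element p n a, e)) ` {0..<2 * length as}"
proof -
  have "layer_element p n a \<in> carrier (layer_group p (padic_int_group p) n)"
    using padic_of_int_closed[OF assms]
    by (auto simp: layer_element_def layer_group_def layer_proj_def FactGroup_def RCOSETS_def)
  then show ?thesis
    by (auto simp: out_arcs_def derived_graph_def layer_vertex_def)
qed

lemma bouquet_layer_head:
  assumes "p > 0"
  shows "head (bouquet_layer p as n) (layer_element p n a, e) =
           layer_vertex p n (a + bouquet_voltage as e)"
  by (simp add: derived_graph_def layer_vertex_def layer_element_mult[OF assms])

lemma serre_graph_bouquet_layer: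
  assumes "p > 0"
  shows "serre_graph (bouquet_layer p as n) (bouquet_layer_arev p as n)"
proof -
  interpret X: serre_graph "bouquet_graph as" "bouquet_arev as" by (rule serre_graph_bouquet)
  interpret D: bidirected_digraph "bouquet_layer p as n" "bouquet_layer_arev p as n"
    by (rule bidirected_derived_graph[OF comm_group_padic_int_group[OF assms]
      X.bidirected_digraph voltage_assignment_bouquet[OF assms]])
  have "finite (carrier (layer_group p (padic_int_group p) n))"
    using bij_betw_finite[OF bij_betw_layer_element[OF assms]] by blast
  then show ?thesis by unfold_locales (simp_all add: derived_graph_def)
qed

text \<open>
  The arcs over a loop of voltage \<open>1\<close> form a cycle through all vertices.
\<close>

lemma bouquet_layer_connected:
  assumes "p > 0" and "1 \<in> set as"
  shows "Digraph_Component.connected (bouquet_layer p as n)"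
proof -
  let ?G = "bouquet_layer p as n"
  interpret serre_graph ?G "bouquet_layer_arev p as n"
    using assms(1) by (rule serre_graph_bouquet_layer)
  have V: "layer_vertex p n (int i) \<in> verts ?G" if "i < p ^ n" for i
    using bij_betw_layer_vertex[OF assms(1), of n as] that by (auto simp: bij_betw_def)
  obtain j where j: "j < length as" "as ! j = 1" using assms(2) by (auto simp: in_set_conv_nth)
  have step: "layer_vertex p n a \<rightarrow>\<^bsub>?G\<^esub> layer_vertex p n (a + 1)" for a
  proof -
    let ?e = "(layer_element p n a, 2 * j)"
    have "?e \<in> out_arcs ?G (layer_vertex p n a)"
      unfolding bouquet_layer_out_arcs[OF assms(1)] using j(1) by simp
    then have e: "?e \<in> arcs ?G" "tail ?G ?e = layer_vertex p n a" by simp_all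
    have "head ?G ?e = layer_vertex p n (a + 1)"
      unfolding bouquet_layer_head[OF assms(1)] by (simp add: bouquet_voltage_def j(2))
    then have "arc_to_ends ?G ?e = (layer_vertex p n a, layer_vertex p n (a + 1))"
      using e(2) by (simp only: arc_to_ends_def)
    then show ?thesis using e(1) unfolding arcs_ends_def by (metis image_eqI)
  qed
  have reach: "layer_vertex p n 0 \<rightarrow>\<^sup>*\<^bsub>?G\<^esub> layer_vertex p n (int i)" if "i < p ^ n" for i
    using that
  proof (induction i)
    case 0
    then show ?case using V[of 0] by simp
  next
    case (Suc i)
    then have "layer_vertex p n 0 \<rightarrow>\<^sup>*\<^bsub>?G\<^esub> layer_vertex p n (int i)" by simp
    moreover have "layer_vertex p n (int i) \<rightarrow>\<^bsub>?G\<^esub> layer_vertex p n (int (Suc i))"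
      using step[of "int i"] by (simp add: add.commute)
    ultimately show ?case by (rule reachable_adj_trans)
  qed
  have sym: "symmetric ?G" by (rule sym_arcs)
  have "\<exists>i<p ^ n. v = layer_vertex p n (int i)" if "v \<in> verts ?G" for v
    using bij_betw_layer_vertex[OF assms(1), of n as] that unfolding bij_betw_def by force
  then have reach_all: "layer_vertex p n 0 \<rightarrow>\<^sup>*\<^bsub>?G\<^esub> v" if "v \<in> verts ?G" for v
    using that reach by metis
  have "u \<rightarrow>\<^sup>*\<^bsub>?G\<^esub> v" if "u \<in> verts ?G" "v \<in> verts ?G" for u v
    using symmetric_reachable[OF sym reach_all[OF that(1)]] reach_all[OF that(2)]
    by (rule reachable_trans)
  moreover have "verts ?G \<noteq> {}" using V[of 0] assms(1) by auto
  ultimately show ?thesis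
    unfolding connected_def strongly_connected_def
    using reachable_mk_symmetric_eq[OF sym] by simp
qed

lemma unramified_Zp_covering_bouquet:
  assumes "prime p" and "1 \<in> set as"
  shows "unramified_Zp_covering p (padic_int_group p) (bouquet_graph as) (bouquet_arev as)
           (\<lambda>e. padic_of_int p (bouquet_voltage as e))"
proof -
  have "p > 0" using assms(1) by (rule prime_gt_0_nat)
  interpret X: serre_graph "bouquet_graph as" "bouquet_arev as" by (rule serre_graph_bouquet)
  interpret \<Gamma>: group "padic_int_group p" using \<open>p > 0\<close> by (rule group_padic_int_group)
  show ?thesis
    by unfold_locales
      (use assms iso_refl voltage_assignment_bouquet[OF \<open>p > 0\<close>]
        bouquet_layer_connected[OF \<open>p > 0\<close> assms(2)] in auto)
qed

text \<open>
  The eigenvalue of the Laplacian of a layer at the root of unity \<open>z\<close>.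
\<close>

definition voltage_symbol :: "int list \<Rightarrow> complex \<Rightarrow> complex" where
  "voltage_symbol as z = (\<Sum>a\<leftarrow>as. 2 - z powi a - z powi (- a))"

lemma sum_bouquet_arcs:
  "(\<Sum>e<2 * length as. h (bouquet_voltage as e)) = (\<Sum>a\<leftarrow>as. h a + h (- a))"
  for h :: "int \<Rightarrow> 'a :: comm_monoid_add"
proof -
  have "(\<Sum>e<2 * m. h (bouquet_voltage as e)) = (\<Sum>j<m. h (as ! j) + h (- (as ! j)))" for m
    by (induction m) (simp_all add: bouquet_voltage_def algebra_simps)
  then show ?thesis by (simp add: sum_list_sum_nth atLeast0LessThan)
qed

text \<open>
  The shifted Laplacian of the layer is a circulant matrix: the constant term \<open>s + 2 * length as\<close> is
  indexed by \<open>None\<close>, and each arc contributes \<open>-1\<close> at its voltage.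
\<close>

lemma det_bouquet_layer_laplacian:
  assumes "p > 0"
  shows "(\<Prod>z\<in>unity_roots (p ^ n). s + voltage_symbol as z) =
    (\<Sum>f\<in>serre_graph.rooted_forests (bouquet_layer p as n).
       s ^ card (serre_graph.roots (bouquet_layer p as n) f))"
proof -
  let ?G = "bouquet_layer p as n" and ?v = "\<lambda>i. layer_vertex p n (int i)" and ?N = "p ^ n"
  let ?E = "insert None (Some ` {..<2 * length as})"
  define a where "a c = (case c of None \<Rightarrow> 0 | Some e \<Rightarrow> bouquet_voltage as e)" for c
  define w where "w c = (case c of None \<Rightarrow> s + of_nat (2 * length as) | Some e \<Rightarrow> -1)" for c :: "nat option"
  interpret serre_graph ?G "bouquet_layer_arev p as n"
    using assms by (rule serre_graph_bouquet_layer)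
  have "?N > 0" using assms by simp
  have eigenvalue: "(\<Sum>c\<in>?E. w c * z powi a c) = s + voltage_symbol as z" for z
  proof -
    have "(\<Sum>c\<in>?E. w c * z powi a c) =
        s + (of_nat (2 * length as) - (\<Sum>e<2 * length as. z powi bouquet_voltage as e))"
      by (simp add: sum.reindex w_def a_def sum_negf image_iff)
    also have "of_nat (2 * length as) - (\<Sum>e<2 * length as. z powi bouquet_voltage as e) =
        (\<Sum>e<2 * length as. 1 - z powi bouquet_voltage as e)"
      by (simp add: sum_subtractf)
    also have "\<dots> = (\<Sum>a\<leftarrow>as. (1 - z powi a) + (1 - z powi (- a)))"
      by (rule sum_bouquet_arcs)
    also have "\<dots> = voltage_symbol as z"
      unfolding voltage_symbol_def by (intro arg_cong[of _ _ sum_list] map_cong refl) simp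
    finally show ?thesis .
  qed
  have entry: "(\<Sum>c\<in>?E. w c * of_bool ((int i + a c) mod int ?N = int j)) =
      s * of_bool (i = j) + (\<Sum>e\<in>out_arcs ?G (?v i). of_bool (i = j) - of_bool (?v j = head ?G e))"
    if ij: "i < ?N" "j < ?N" for i j
  proof -
    have hit: "?v j = layer_vertex p n b \<longleftrightarrow> b mod int ?N = int j" for b
    proof -
      have "int j mod int ?N = int j" using ij(2) by simp
      then show ?thesis unfolding layer_vertex_eq_iff[OF assms] by auto
    qed
    have diag: "(int i mod int ?N = int j) = (i = j)" using ij by simp
    define hits :: "nat \<Rightarrow> complex"
      where "hits e = of_bool ((int i + bouquet_voltage as e) mod int ?N = int j)" for e
    have arcs_sum: "(\<Sum>e\<in>out_arcs ?G (?v i). of_bool (i = j) - of_bool (?v j = head ?G e)) =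
        (\<Sum>e<2 * length as. of_bool (i = j) - hits e)"
      unfolding bouquet_layer_out_arcs[OF assms]
      by (subst sum.reindex)
        (auto intro!: inj_onI sum.cong simp only: comp_def bouquet_layer_head[OF assms] hit atLeast0LessThan hits_def)
    have split: "(\<Sum>c\<in>?E. F c) = F None + (\<Sum>e<2 * length as. F (Some e))" for F :: "nat option \<Rightarrow> complex"
      by (subst sum.insert) (auto simp: sum.reindex)
    have "(\<Sum>c\<in>?E. w c * of_bool ((int i + a c) mod int ?N = int j)) =
        (s + of_nat (2 * length as)) * of_bool (i = j) + (\<Sum>e<2 * length as. -1 * hits e)"
      unfolding split by (simp only: w_def a_def option.case add_0_right diag hits_def)
    also have "\<dots> = s * of_bool (i = j) + (\<Sum>e<2 * length as. of_bool (i = j) - hits e)"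
      by (simp add: sum_negf sum_subtractf distrib_right)
    finally show ?thesis unfolding arcs_sum .
  qed
  have "(\<Prod>z\<in>unity_roots ?N. s + voltage_symbol as z) = det (circulant ?N ?E a w)"
    by (simp only: det_circulant[OF \<open>?N > 0\<close>] eigenvalue finite.intros finite_imageI finite_lessThan)
  also have "circulant ?N ?E a w = mat ?N ?N (\<lambda>(i, j). s * of_bool (i = j) +
      (\<Sum>e\<in>out_arcs ?G (?v i). of_bool (i = j) - of_bool (?v j = head ?G e)))"
    unfolding circulant_def by (rule eq_matI) (simp_all only: entry dim_row_mat dim_col_mat index_mat prod.case)
  also have "det \<dots> = (\<Sum>f\<in>rooted_forests. s ^ card (roots f))"
    by (rule det_shifted_laplacian[OF bij_betw_layer_vertex[OF assms]])
  finally show ?thesis .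
qed

text \<open>
  Both expressions for the determinant of the Laplacian shifted by \<open>s\<close> are divisible by \<open>s\<close>, one because the
  eigenvalue at \<open>1\<close> is \<open>0\<close>, the other by the expansion over forests. After division, let \<open>s\<close> tend to \<open>0\<close>.
\<close>

theorem bouquet_layer_tree_number:
  assumes "p > 0"
  shows "of_nat (p ^ n * layer_tree_number p (padic_int_group p) (bouquet_graph as) (bouquet_arev as)
            (\<lambda>e. padic_of_int p (bouquet_voltage as e)) n) =
         (\<Prod>z\<in>unity_roots (p ^ n) - {1}. voltage_symbol as z)"
proof -
  let ?G = "bouquet_layer p as n" and ?N = "p ^ n"
  interpret serre_graph ?G "bouquet_layer_arev p as n"
    using assms by (rule serre_graph_bouquet_layer)
  let ?\<kappa> = "num_spanning_trees ?G (bouquet_layer_arev p as n)"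
  have "?N > 0" using assms by simp
  have card: "card (verts ?G) = ?N"
    using bij_betw_same_card[OF bij_betw_layer_vertex[OF assms, of n as]] by simp
  then have "verts ?G \<noteq> {}" using \<open>?N > 0\<close> by auto
  \<comment> \<open>The cofactor of \<open>s\<^sup>2\<close> in the expansion over forests; continuous in \<open>s\<close> as a finite sum of powers.\<close>
  define q where "q s = (\<Sum>f | f \<in> rooted_forests \<and> 2 \<le> card (roots f). s ^ (card (roots f) - 2))" for s :: complex
  have fin: "finite (unity_roots ?N)" using \<open>?N > 0\<close> by (intro finite_roots_unity) linarith
  have "voltage_symbol as 1 = 0" by (simp add: voltage_symbol_def)
  have identity: "(\<Prod>z\<in>unity_roots ?N - {1}. s + voltage_symbol as z) = of_nat (?N * ?\<kappa>) + s * q s"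
    if "s \<noteq> 0" for s
  proof -
    have "s * (\<Prod>z\<in>unity_roots ?N - {1}. s + voltage_symbol as z) =
        (\<Prod>z\<in>unity_roots ?N. s + voltage_symbol as z)"
      using prod.remove[OF fin, of 1 "\<lambda>z. s + voltage_symbol as z"] \<open>voltage_symbol as 1 = 0\<close> by simp
    also have "\<dots> = s * of_nat (?N * ?\<kappa>) + s\<^sup>2 * q s"
      unfolding det_bouquet_layer_laplacian[OF assms] rooted_forest_polynomial[OF \<open>verts ?G \<noteq> {}\<close>] card q_def ..
    also have "\<dots> = s * (of_nat (?N * ?\<kappa>) + s * q s)"
      by (simp only: distrib_left power2_eq_square mult.assoc)
    finally show ?thesis using that by (simp only: mult_cancel_left simp_thms)
  qed
  have "((\<lambda>s. \<Prod>z\<in>unity_roots ?N - {1}. s + voltage_symbol as z) \<longlongrightarrow>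
      (\<Prod>z\<in>unity_roots ?N - {1}. 0 + voltage_symbol as z)) (at 0)"
    by (intro tendsto_intros)
  moreover have "((\<lambda>s. \<Prod>z\<in>unity_roots ?N - {1}. s + voltage_symbol as z) \<longlongrightarrow>
      of_nat (?N * ?\<kappa>) + 0 * q 0) (at 0)"
  proof (rule Lim_transform_eventually)
    show "((\<lambda>s. of_nat (?N * ?\<kappa>) + s * q s) \<longlongrightarrow> of_nat (?N * ?\<kappa>) + 0 * q 0) (at 0)"
      unfolding q_def by (intro tendsto_intros)
    show "\<forall>\<^sub>F s in at 0. of_nat (?N * ?\<kappa>) + s * q s =
        (\<Prod>z\<in>unity_roots ?N - {1}. s + voltage_symbol as z)"
      unfolding eventually_at_filter
    proof (intro always_eventually allI impI)
      fix s :: complex assume "s \<noteq> 0"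
      then show "of_nat (?N * ?\<kappa>) + s * q s = (\<Prod>z\<in>unity_roots ?N - {1}. s + voltage_symbol as z)"
        by (rule identity[symmetric])
    qed
  qed
  ultimately have "(\<Prod>z\<in>unity_roots ?N - {1}. 0 + voltage_symbol as z) = of_nat (?N * ?\<kappa>) + 0 * q 0"
    by (rule tendsto_unique[OF at_neq_bot])
  then show ?thesis by (simp add: layer_tree_number_def)
qed

section \<open>A bouquet with prescribed invariants\<close>

lemma sum_centered:
  fixes h :: "nat \<Rightarrow> 'a :: comm_monoid_add"
  shows "(\<Sum>i\<le>2 * k. h i) = h k + (\<Sum>a=1..k. h (k + a) + h (k - a))"
proof -
  have split: "{..2 * k} = insert k ({..<k} \<union> {k<..2 * k})" by auto
  have "(\<Sum>i\<le>2 * k. h i) = h k + sum h ({..<k} \<union> {k<..2 * k})"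
    unfolding split by (rule sum.insert) auto
  also have "sum h ({..<k} \<union> {k<..2 * k}) = (\<Sum>i<k. h i) + (\<Sum>i\<in>{k<..2 * k}. h i)"
    by (rule sum.union_disjoint) auto
  also have "(\<Sum>i<k. h i) = (\<Sum>a=1..k. h (k - a))"
    by (rule sum.reindex_bij_witness[of _ "\<lambda>a. k - a" "\<lambda>i. k - i"]) auto
  also have "(\<Sum>i\<in>{k<..2 * k}. h i) = (\<Sum>a=1..k. h (k + a))"
    by (rule sum.reindex_bij_witness[of _ "\<lambda>a. k + a" "\<lambda>i. i - k"]) auto
  finally show ?thesis by (simp add: sum.distrib ac_simps)
qed

text \<open>
  Up to a factor \<open>z ^ k\<close>, this expresses the \<open>k\<close>-th power of \<open>2 - z - 1 / z\<close> in terms of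
  \<open>2 - z ^ a - 1 / z ^ a\<close>. Collect the terms of the binomial expansion symmetrically about the middle one, and
  eliminate the middle coefficient with the help of the vanishing at \<open>z = 1\<close>.
\<close>

lemma one_minus_power_eq_symbols:
  fixes z :: "'a :: comm_ring_1"
  assumes "k \<ge> 1"
  shows "(-1) ^ k * (1 - z) ^ (2 * k) =
    (\<Sum>a=1..k. (-1) ^ (a + 1) * of_nat (2 * k choose (k + a)) * (2 * z ^ k - z ^ (k + a) - z ^ (k - a)))"
proof -
  define C :: "nat \<Rightarrow> 'a" where "C a = (-1) ^ a * of_nat (2 * k choose (k + a))" for a
  have expand: "(-1) ^ k * (1 - x) ^ (2 * k) = C 0 * x ^ k + (\<Sum>a=1..k. C a * (x ^ (k + a) + x ^ (k - a)))"
    for x :: 'a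
  proof -
    have "(-1) ^ k * (1 - x) ^ (2 * k) = (-1) ^ k * (- x + 1) ^ (2 * k)" by simp
    also have "\<dots> = (\<Sum>i\<le>2 * k. (-1) ^ k * (of_nat (2 * k choose i) * (- x) ^ i))"
      unfolding binomial_ring sum_distrib_left by simp
    also have "\<dots> = (\<Sum>i\<le>2 * k. (-1) ^ (k + i) * of_nat (2 * k choose i) * x ^ i)"
      by (intro sum.cong refl) (simp add: power_minus[of x] power_add mult_ac)
    also have "\<dots> = (-1) ^ (k + k) * of_nat (2 * k choose k) * x ^ k +
        (\<Sum>a=1..k. (-1) ^ (k + (k + a)) * of_nat (2 * k choose (k + a)) * x ^ (k + a) +
            (-1) ^ (k + (k - a)) * of_nat (2 * k choose (k - a)) * x ^ (k - a))"
      by (rule sum_centered)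
    also have "\<dots> = C 0 * x ^ k + (\<Sum>a=1..k. C a * (x ^ (k + a) + x ^ (k - a)))"
    proof (intro arg_cong2[of _ _ _ _ "(+)"] sum.cong refl)
      show "(-1) ^ (k + k) * of_nat (2 * k choose k) * x ^ k = C 0 * x ^ k"
        by (simp add: C_def power_add flip: power_mult_distrib)
    next
      fix a assume a: "a \<in> {1..k}"
      have "2 * k choose (k - a) = 2 * k choose (k + a)"
        using a binomial_symmetric[of "k + a" "2 * k"] by (simp add: mult_2)
      moreover have "(-1 :: 'a) ^ (k + (k + a)) = (-1) ^ a" by (simp add: power_add flip: power_mult_distrib)
      moreover have "(-1 :: 'a) ^ (k + (k - a)) = (-1) ^ a"
      proof -
        have "k + (k - a) = 2 * (k - a) + a" using a unfolding atLeastAtMost_iff by arith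
        then show ?thesis by (simp only: power_add power_mult) simp
      qed
      ultimately show "(-1) ^ (k + (k + a)) * of_nat (2 * k choose (k + a)) * x ^ (k + a) +
          (-1) ^ (k + (k - a)) * of_nat (2 * k choose (k - a)) * x ^ (k - a) =
          C a * (x ^ (k + a) + x ^ (k - a))"
        by (simp add: C_def distrib_left)
    qed
    finally show ?thesis .
  qed
  have "0 = C 0 + (\<Sum>a=1..k. C a * 2)"
    using expand[of 1] assms by (simp add: power_0_left)
  then have "C 0 = (\<Sum>a=1..k. - (C a * 2))"
    unfolding sum_negf eq_neg_iff_add_eq_0 by (rule sym)
  then have constant_term: "C 0 * z ^ k = (\<Sum>a=1..k. - (C a * 2 * z ^ k))"
    by (simp only: sum_distrib_right mult_minus_left)
  have "(-1) ^ k * (1 - z) ^ (2 * k) =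
      (\<Sum>a=1..k. - (C a * 2 * z ^ k) + C a * (z ^ (k + a) + z ^ (k - a)))"
    unfolding expand[of z] constant_term sum.distrib ..
  also have "\<dots> = (\<Sum>a=1..k. (-1) ^ (a + 1) * of_nat (2 * k choose (k + a)) *
      (2 * z ^ k - z ^ (k + a) - z ^ (k - a)))"
    by (intro sum.cong refl) (simp add: C_def algebra_simps)
  finally show ?thesis .
qed

text \<open>
  The signed coefficient \<open>(-1) ^ (a + 1) * (2 * k choose (k + a))\<close> of the \<open>k\<close>-th power, made positive by adding
  \<open>p * (2 * k choose (k + a))\<close>.
\<close>

definition voltage_multiplicity :: "nat \<Rightarrow> nat \<Rightarrow> nat \<Rightarrow> nat" where
  "voltage_multiplicity p k a = (2 * k choose (k + a)) * (if odd a then p + 1 else p - 1)"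

definition voltage_list :: "nat \<Rightarrow> nat \<Rightarrow> nat \<Rightarrow> int list" where
  "voltage_list p k m =
     concat (map (\<lambda>a. replicate (p ^ m * voltage_multiplicity p k a) (int a)) [1..<Suc k])"

text \<open>
  The eigenvalue for \<open>voltage_list\<close>, without the factor \<open>p ^ m\<close>.
\<close>

definition reduced_symbol :: "nat \<Rightarrow> nat \<Rightarrow> complex \<Rightarrow> complex" where
  "reduced_symbol p k z =
     (\<Sum>a=1..k. of_nat (voltage_multiplicity p k a) * (2 - z powi int a - z powi (- int a)))"

lemma voltage_symbol_voltage_list:
  "voltage_symbol (voltage_list p k m) z = of_nat (p ^ m) * reduced_symbol p k z"
proof -
  have "voltage_symbol (concat (map (\<lambda>a. replicate (c a) (int a)) as)) z =
      (\<Sum>a\<leftarrow>as. of_nat (c a) * (2 - z powi int a - z powi (- int a)))" for c as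
    by (induction as) (simp_all add: voltage_symbol_def sum_list_replicate)
  then have "voltage_symbol (voltage_list p k m) z =
      (\<Sum>a\<leftarrow>[1..<Suc k]. of_nat (p ^ m * voltage_multiplicity p k a) * (2 - z powi int a - z powi (- int a)))"
    by (simp add: voltage_list_def)
  also have "\<dots> = (\<Sum>a=1..k. of_nat (p ^ m * voltage_multiplicity p k a) * (2 - z powi int a - z powi (- int a)))"
    by (simp only: interv_sum_list_conv_sum_set_nat set_upt atLeastLessThanSuc_atLeastAtMost)
  finally show ?thesis by (simp add: reduced_symbol_def sum_distrib_left mult.assoc)
qed

lemma one_mem_voltage_list:
  assumes "p > 0" "k \<ge> 1"
  shows "1 \<in> set (voltage_list p k m)"
proof -
  have "1 \<in> set (replicate (p ^ m * voltage_multiplicity p k 1) (int 1))"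
    using assms by (simp add: voltage_multiplicity_def)
  moreover have "1 \<in> set [1..<Suc k]" unfolding set_upt using assms by simp
  ultimately show ?thesis unfolding voltage_list_def set_concat set_map by blast
qed

text \<open>
  The factor \<open>z ^ k\<close> clears the denominators; it does not change absolute values at roots of unity.
\<close>

lemma reduced_symbol_expansion:
  assumes p: "p > 0" and k: "k \<ge> 1"
  shows "\<exists>H. \<forall>z. z \<noteq> 0 \<longrightarrow> z ^ k * reduced_symbol p k z =
           of_int ((-1) ^ k) * (1 - z) ^ (2 * k) + of_nat p * int_poly_at H z"
proof (intro exI allI impI)
  let ?H = "\<Sum>a=1..k. Polynomial.smult (int (2 * k choose (k + a))) (monom 2 k - monom 1 (k + a) - monom 1 (k - a))"
  fix z :: complex assume z: "z \<noteq> 0"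
  define u where "u a = 2 * z ^ k - z ^ (k + a) - z ^ (k - a)" for a
  have mult: "of_nat (voltage_multiplicity p k a) =
      (of_nat (2 * k choose (k + a)) * ((-1) ^ (a + 1) + of_nat p) :: complex)" for a
    using p by (simp add: voltage_multiplicity_def of_nat_diff Suc_le_eq)
  have shift: "z ^ k * (2 - z powi int a - z powi (- int a)) = u a" if "a \<in> {1..k}" for a
  proof -
    have "z ^ k * z powi (- int a) = z ^ (k - a)"
      using that z by (simp add: power_int_minus power_diff divide_inverse)
    then show ?thesis by (simp add: u_def right_diff_distrib power_add)
  qed
  have "z ^ k * reduced_symbol p k z =
      (\<Sum>a=1..k. of_nat (voltage_multiplicity p k a) * (z ^ k * (2 - z powi int a - z powi (- int a))))"
    by (simp only: reduced_symbol_def sum_distrib_left mult.left_commute)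
  also have "\<dots> = (\<Sum>a=1..k. of_nat (voltage_multiplicity p k a) * u a)"
    by (intro sum.cong refl) (simp only: shift)
  also have "\<dots> = (\<Sum>a=1..k. (-1) ^ (a + 1) * of_nat (2 * k choose (k + a)) * u a) +
      of_nat p * (\<Sum>a=1..k. of_nat (2 * k choose (k + a)) * u a)"
    unfolding mult sum_distrib_left sum.distrib[symmetric]
    by (intro sum.cong refl) (simp only: distrib_left distrib_right mult_ac)
  also have "(\<Sum>a=1..k. (-1) ^ (a + 1) * of_nat (2 * k choose (k + a)) * u a) = (-1) ^ k * (1 - z) ^ (2 * k)"
    unfolding u_def by (rule one_minus_power_eq_symbols[OF k, symmetric])
  also have "(\<Sum>a=1..k. of_nat (2 * k choose (k + a)) * u a) = int_poly_at ?H z"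
    by (simp only: int_poly_at_simps u_def) simp
  finally show "z ^ k * reduced_symbol p k z =
      of_int ((-1) ^ k) * (1 - z) ^ (2 * k) + of_nat p * int_poly_at ?H z" by simp
qed

lemma norm_unity_root:
  assumes "z \<in> unity_roots N" "N > 0"
  shows "cmod z = 1"
proof (rule power_eq_imp_eq_base)
  show "cmod z ^ N = 1 ^ N" using assms(1) by (simp flip: norm_power)
qed (use assms in auto)

text \<open>
  Every summand has a nonnegative real part, and for \<open>a = 1\<close> it is positive since \<open>z \<noteq> 1\<close>.
\<close>

lemma reduced_symbol_nonzero:
  assumes p: "p > 0" and k: "k \<ge> 1" and z: "z \<in> unity_roots N - {1}" "N > 0"
  shows "reduced_symbol p k z \<noteq> 0"
proof -
  have z_norm: "cmod z = 1" using norm_unity_root[of z N] z by simp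
  have Re_term: "Re (2 - w - inverse w) = 2 - 2 * Re w" if "cmod w = 1" for w
  proof -
    have "(Re w)\<^sup>2 + (Im w)\<^sup>2 = 1" using that by (simp add: cmod_def)
    then show ?thesis by simp
  qed
  have nonneg: "Re (2 - z powi int a - z powi (- int a)) \<ge> 0" for a
  proof -
    have "cmod (z ^ a) = 1" using z_norm by (simp add: norm_power)
    then have "Re (2 - z ^ a - inverse (z ^ a)) = 2 - 2 * Re (z ^ a)" "Re (z ^ a) \<le> 1"
      using Re_term complex_Re_le_cmod[of "z ^ a"] by simp_all
    then show ?thesis by (simp add: power_int_minus)
  qed
  have "Re z < 1"
  proof (rule ccontr)
    assume "\<not> Re z < 1"
    then have "Re z = 1" using complex_Re_le_cmod[of z] z_norm by simp
    moreover from this have "Im z = 0" using z_norm by (simp add: cmod_def)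
    ultimately have "z = 1" by (simp add: complex_eq_iff)
    then show False using z(1) by simp
  qed
  then have pos: "Re (2 - z powi int 1 - z powi (- int 1)) > 0"
    using Re_term[OF z_norm] by (simp add: power_int_minus)
  have "Re (reduced_symbol p k z) =
      (\<Sum>a=1..k. real (voltage_multiplicity p k a) * Re (2 - z powi int a - z powi (- int a)))"
    unfolding reduced_symbol_def Re_sum by (intro sum.cong refl) simp
  also have "\<dots> > 0"
  proof (rule sum_pos2[of _ 1])
    show "0 < real (voltage_multiplicity p k 1) * Re (2 - z powi int 1 - z powi (- int 1))"
    proof (rule mult_pos_pos[OF _ pos])
      show "0 < real (voltage_multiplicity p k 1)"
        unfolding of_nat_0_less_iff using k by (simp add: voltage_multiplicity_def)
    qed
  qed (use k nonneg in \<open>auto intro: mult_nonneg_nonneg\<close>)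
  finally show ?thesis by auto
qed

abbreviation tower_tree_number :: "nat \<Rightarrow> nat \<Rightarrow> nat \<Rightarrow> nat \<Rightarrow> nat" where
  "tower_tree_number p k m n \<equiv>
     layer_tree_number p (padic_int_group p) (bouquet_graph (voltage_list p k m))
       (bouquet_arev (voltage_list p k m)) (\<lambda>e. padic_of_int p (bouquet_voltage (voltage_list p k m) e)) n"

lemma tower_tree_number_eq:
  assumes "p > 0"
  shows "of_nat (p ^ n * tower_tree_number p k m n) =
           (\<Prod>z\<in>unity_roots (p ^ n) - {1}. of_nat (p ^ m) * reduced_symbol p k z)"
  unfolding bouquet_layer_tree_number[OF assms] voltage_symbol_voltage_list ..

lemma tower_tree_number_pos:
  assumes "p > 0" "k \<ge> 1"
  shows "tower_tree_number p k m n > 0"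
proof -
  have "p ^ n > 0" using assms by simp
  then have "finite (unity_roots (p ^ n))" by (intro finite_roots_unity) linarith
  then have "(\<Prod>z\<in>unity_roots (p ^ n) - {1}. of_nat (p ^ m) * reduced_symbol p k z) \<noteq> 0"
    using reduced_symbol_nonzero[OF assms _ \<open>p ^ n > 0\<close>] assms(1) by (auto simp: prod_zero_iff)
  then have "p ^ n * tower_tree_number p k m n \<noteq> 0"
    unfolding tower_tree_number_eq[OF assms(1), symmetric] of_nat_eq_0_iff .
  then show ?thesis by simp
qed

text \<open>
  The quotient of the products for consecutive layers is a product over primitive roots of unity,
  whose valuation is known up to the cofactors \<open>a\<close> and \<open>b\<close>. Taking absolute values removes the factors
  \<open>z ^ k\<close> and leads to an equation between natural numbers.
\<close>

lemma tower_tree_number_step: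
  assumes p: "prime p" and k: "k \<ge> 1" and large: "2 * k < p ^ Suc n - p ^ n"
  shows "\<exists>a b :: nat. \<not> p dvd a \<and> \<not> p dvd b \<and>
    p * tower_tree_number p k m (Suc n) * b =
    tower_tree_number p k m n * p ^ (m * (p ^ Suc n - p ^ n) + 2 * k) * a"
proof -
  let ?prim = "unity_roots (p ^ Suc n) - unity_roots (p ^ n)"
  have pos: "p > 0" "p ^ n > 0" "p ^ Suc n > 0" using p prime_gt_0_nat by auto
  have prim_nz: "z \<noteq> 0" if "z \<in> ?prim" for z
    using that pos by (auto simp: power_0_left simp del: power_Suc)
  have fin: "finite (unity_roots (p ^ Suc n))"
    using pos(3) by (intro finite_roots_unity) linarith
  from reduced_symbol_expansion[OF pos(1) k] obtain H
    where H: "\<forall>z. z \<noteq> 0 \<longrightarrow> z ^ k * reduced_symbol p k z =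
           of_int ((-1) ^ k) * (1 - z) ^ (2 * k) + of_nat p * int_poly_at H z" ..
  have "\<not> int p dvd (-1) ^ k" using p by (cases "even k") (auto simp: prime_nat_iff)
  from primitive_root_product_valuation[OF p this large, of H] obtain a b where
    ab: "\<not> int p dvd a" "\<not> int p dvd b" and
    "(\<Prod>z\<in>?prim. of_int ((-1) ^ k) * (1 - z) ^ (2 * k) + of_nat p * int_poly_at H z) * of_int b =
      of_nat p ^ (2 * k) * of_int a"
    by (elim exE conjE)
  then have "(\<Prod>z\<in>?prim. z ^ k * reduced_symbol p k z) * of_int b = of_nat p ^ (2 * k) * of_int a"
    using H prim_nz by simp
  then have "cmod ((\<Prod>z\<in>?prim. z ^ k * reduced_symbol p k z) * of_int b) =
      cmod (of_nat p ^ (2 * k) * of_int a)" by simp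
  moreover have "cmod (z ^ k) = 1" if "z \<in> ?prim" for z
  proof -
    have "cmod z = 1" using norm_unity_root[OF _ pos(3)] that by simp
    then show ?thesis by (simp add: norm_power)
  qed
  ultimately have prim_norm: "(\<Prod>z\<in>?prim. cmod (reduced_symbol p k z)) * real (nat \<bar>b\<bar>) =
      real p ^ (2 * k) * real (nat \<bar>a\<bar>)"
    by (simp add: norm_mult norm_power flip: prod_norm)
  have "(\<Prod>z\<in>unity_roots (p ^ Suc n) - {1}. of_nat (p ^ m) * reduced_symbol p k z) =
      (\<Prod>z\<in>unity_roots (p ^ Suc n) - {1} - (unity_roots (p ^ n) - {1}). of_nat (p ^ m) * reduced_symbol p k z) *
      (\<Prod>z\<in>unity_roots (p ^ n) - {1}. of_nat (p ^ m) * reduced_symbol p k z)"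
    using unity_roots_prime_power_Suc fin by (intro prod.subset_diff) auto
  also have "unity_roots (p ^ Suc n) - {1} - (unity_roots (p ^ n) - {1}) = ?prim" by auto
  finally have "complex_of_nat (p ^ Suc n * tower_tree_number p k m (Suc n)) =
      (\<Prod>z\<in>?prim. of_nat (p ^ m) * reduced_symbol p k z) * of_nat (p ^ n * tower_tree_number p k m n)"
    unfolding tower_tree_number_eq[OF pos(1)] .
  then have "cmod (complex_of_nat (p ^ Suc n * tower_tree_number p k m (Suc n))) =
      cmod ((\<Prod>z\<in>?prim. of_nat (p ^ m) * reduced_symbol p k z) * of_nat (p ^ n * tower_tree_number p k m n))"
    by (rule arg_cong)
  then have "real (p ^ Suc n * tower_tree_number p k m (Suc n)) =
      real (p ^ m) ^ card ?prim * (\<Prod>z\<in>?prim. cmod (reduced_symbol p k z)) * real (p ^ n * tower_tree_number p k m n)"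
    by (simp only: norm_mult norm_of_nat norm_power prod_norm[symmetric] prod.distrib prod_constant)
  then have "real (p ^ Suc n * tower_tree_number p k m (Suc n)) * real (nat \<bar>b\<bar>) =
      real (p ^ m) ^ card ?prim * real (p ^ n * tower_tree_number p k m n) *
      ((\<Prod>z\<in>?prim. cmod (reduced_symbol p k z)) * real (nat \<bar>b\<bar>))"
    by (simp only: mult_ac)
  also have "\<dots> = real (p ^ m) ^ card ?prim * real (p ^ n * tower_tree_number p k m n) *
      (real p ^ (2 * k) * real (nat \<bar>a\<bar>))"
    unfolding prim_norm ..
  also have "\<dots> = real (p ^ n * (tower_tree_number p k m n * p ^ (m * (p ^ Suc n - p ^ n) + 2 * k) * nat \<bar>a\<bar>))"
    unfolding card_primitive_roots[OF p] by (simp add: power_add power_mult mult_ac del: power_Suc)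
  finally have "real (p ^ n * (p * tower_tree_number p k m (Suc n) * nat \<bar>b\<bar>)) =
      real (p ^ n * (tower_tree_number p k m n * p ^ (m * (p ^ Suc n - p ^ n) + 2 * k) * nat \<bar>a\<bar>))"
    by (simp add: mult_ac)
  then have "p * tower_tree_number p k m (Suc n) * nat \<bar>b\<bar> =
      tower_tree_number p k m n * p ^ (m * (p ^ Suc n - p ^ n) + 2 * k) * nat \<bar>a\<bar>"
    unfolding of_nat_eq_iff using pos(1) by simp
  moreover have "\<not> p dvd nat \<bar>a\<bar>" "\<not> p dvd nat \<bar>b\<bar>"
    using ab by (simp_all add: nat_abs_dvd_iff[symmetric] int_dvd_int_iff[symmetric])
  ultimately show ?thesis by blast
qed

lemma multiplicity_tower_tree_number_Suc:
  assumes p: "prime p" and k: "k \<ge> 1" and large: "2 * k < p ^ Suc n - p ^ n"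
  shows "multiplicity p (tower_tree_number p k m (Suc n)) + 1 =
    multiplicity p (tower_tree_number p k m n) + m * (p ^ Suc n - p ^ n) + 2 * k"
proof -
  have pe: "prime_elem p" using p by simp
  have "p > 0" using p by (rule prime_gt_0_nat)
  note nz = tower_tree_number_pos[OF \<open>p > 0\<close> k, of m, THEN gr_implies_not0]
  from tower_tree_number_step[OF p k large, of m] obtain a b where
    ab: "\<not> p dvd a" "\<not> p dvd b" and
    eq: "p * tower_tree_number p k m (Suc n) * b =
      tower_tree_number p k m n * p ^ (m * (p ^ Suc n - p ^ n) + 2 * k) * a"
    by (elim exE conjE)
  have ab0: "a \<noteq> 0" "b \<noteq> 0" using ab by (metis dvd_0_right)+
  have unit_part: "multiplicity p a = 0" "multiplicity p b = 0"
    using ab by (simp_all add: not_dvd_imp_multiplicity_0)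
  have self: "multiplicity p p = 1" using p by (simp add: multiplicity_self prime_nat_iff)
  have "multiplicity p (p * tower_tree_number p k m (Suc n) * b) =
      1 + multiplicity p (tower_tree_number p k m (Suc n))"
    using nz ab0 \<open>p > 0\<close> by (simp add: prime_elem_multiplicity_mult_distrib[OF pe] unit_part self)
  moreover have "multiplicity p (tower_tree_number p k m n * p ^ (m * (p ^ Suc n - p ^ n) + 2 * k) * a) =
      multiplicity p (tower_tree_number p k m n) + (m * (p ^ Suc n - p ^ n) + 2 * k)"
    using nz ab0 \<open>p > 0\<close>
    by (simp add: prime_elem_multiplicity_mult_distrib[OF pe] prime_elem_multiplicity_power_distrib[OF pe]
      unit_part self del: power_Suc)
  ultimately show ?thesis unfolding eq by simp
qed

text \<open>
  Since \<open>n < p ^ n \<le> p ^ Suc n - p ^ n\<close>, the step formula holds from \<open>n = 2 * k\<close> on, and this value determines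
  the constant \<open>\<nu>\<close>.
\<close>

lemma bouquet_tower_iwasawa_invariants:
  assumes p: "prime p" and k: "k \<ge> 1"
  shows "has_iwasawa_invariants p (padic_int_group p) (bouquet_graph (voltage_list p k m))
    (bouquet_arev (voltage_list p k m)) (\<lambda>e. padic_of_int p (bouquet_voltage (voltage_list p k m) e))
    (2 * k - 1) m"
proof -
  define v where "v n = int (multiplicity p (tower_tree_number p k m n))" for n
  define \<nu> where "\<nu> = v (2 * k) - int (2 * k - 1) * int (2 * k) - int m * int p ^ (2 * k)"
  have "p \<ge> 2" using p by (rule prime_ge_2_nat)
  have "v n = int (2 * k - 1) * int n + int m * int p ^ n + \<nu>" if "n \<ge> 2 * k" for n
    using that
  proof (induction rule: dec_induct)
    case base
    then show ?case by (simp add: \<nu>_def)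
  next
    case (step n)
    have "n < p ^ n" by (rule power_gt_expt) (use \<open>p \<ge> 2\<close> in simp)
    moreover have double: "p ^ n + p ^ n \<le> p ^ Suc n"
      using mult_le_mono1[OF \<open>p \<ge> 2\<close>, of "p ^ n"] unfolding power_Suc mult_2 .
    ultimately have large: "2 * k < p ^ Suc n - p ^ n" using step.hyps by linarith
    have "v (Suc n) + 1 = v n + int m * int (p ^ Suc n - p ^ n) + 2 * int k"
      using multiplicity_tower_tree_number_Suc[OF p k large, of m] unfolding v_def
      by (simp del: power_Suc flip: of_nat_mult of_nat_add of_nat_Suc)
    moreover have "int (p ^ Suc n - p ^ n) = int p ^ Suc n - int p ^ n"
      using double by (simp add: of_nat_diff del: power_Suc)
    moreover have "int (2 * k - 1) = 2 * int k - 1" using k by (simp add: of_nat_diff)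
    ultimately show ?case using step.IH by (simp add: algebra_simps del: power_Suc)
  qed
  then show ?thesis
    unfolding has_iwasawa_invariants_def v_def eventually_sequentially by blast
qed

theorem theorem1p1:
  fixes p l m :: nat
  assumes "prime p" and "odd l" and "l \<ge> 1"
  shows "\<exists>(\<Gamma> :: (nat \<Rightarrow> int) monoid) (X :: (nat, nat) pre_digraph) arev \<alpha>.
           unramified_Zp_covering p \<Gamma> X arev \<alpha>
         \<and> bouquet X
         \<and> has_iwasawa_invariants p \<Gamma> X arev \<alpha> l m"
proof -
  from \<open>odd l\<close> obtain j where "l = 2 * j + 1" by (rule oddE)
  then have l: "l = 2 * Suc j - 1" by simp
  have "p > 0" using assms(1) by (rule prime_gt_0_nat)
  let ?as = "voltage_list p (Suc j) m"
  have "unramified_Zp_covering p (padic_int_group p) (bouquet_graph ?as) (bouquet_arev ?as)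
      (\<lambda>e. padic_of_int p (bouquet_voltage ?as e))"
    by (rule unramified_Zp_covering_bouquet[OF assms(1) one_mem_voltage_list[OF \<open>p > 0\<close>]]) simp
  moreover have "bouquet (bouquet_graph ?as)" by (simp add: bouquet_def)
  moreover have "has_iwasawa_invariants p (padic_int_group p) (bouquet_graph ?as) (bouquet_arev ?as)
      (\<lambda>e. padic_of_int p (bouquet_voltage ?as e)) l m"
    unfolding l by (rule bouquet_tower_iwasawa_invariants[OF assms(1)]) simp
  ultimately show ?thesis by blast
qed

end
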